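(* Let $\mathcal{M}_1=\{p_{\theta^1}(x_1)\},\ldots,\mathcal{M}_k=\{p_{\theta^k}(x_k)\}$ be $k$ regular statistical models with variables $x_i\in\mathbb{R}^{d_i}$, parameters $\theta^i\in\Theta_i\subset\mathbb{R}^{m_i}$ ($\Theta_i$ open and connected) and Fisher-Rao distances $\rho_{\mathcal{M}_1},\ldots,\rho_{\mathcal{M}_k}$. Consider the product model of stochastically independent variables $$\mathcal{M}=\Big\{p_\theta(x)=\prod_{i=1}^k p_{\theta^i}(x_i)\ :\ \theta=(\theta^1,\ldots,\theta^k)\in\Theta_1\times\cdots\times\Theta_k\Big\},\qquad x=(x_1,\ldots,x_k).$$ Then for all $\theta_0=(\theta_0^1,\ldots,\theta_0^k)$ and $\theta_1=(\theta_1^1,\ldots,\theta_1^k)$ in $\Theta_1\times\cdots\times\Theta_k$, $$\rho_{\mathcal{M}}(\theta_0,\theta_1)=\sqrt{\sum_{i=1}^k\rho_{\mathcal{M}_i}^2(\theta_0^i,\theta_1^i)}.$$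
   Context: A statistical model is a family of probability densities $p_\theta$ with respect to a fixed positive measure, indexed by $\theta$ in a connected open set $\Theta\subset\mathbb{R}^m$; it is assumed regular, so that the Fisher information matrix $I(\theta)=E_{p_\theta}[\nabla_\theta\log p_\theta\,(\nabla_\theta\log p_\theta)^\top]$ is well defined, positive-definite and smooth in $\theta$, and the score $\nabla_\theta\log p_\theta$ has zero expectation under $p_\theta$. The Fisher metric is the Riemannian metric on $\Theta$ with matrix $I(\theta)$, and the Fisher-Rao distance is its Riemannian distance: the infimum of $\int_0^1\sqrt{\dot c(t)^\top I(c(t))\,\dot c(t)}\,dt$ over piecewise smooth curves $c:[0,1]\to\Theta$ joining the two parameters. The product model is dominated by the product of the dominating measures. *)

theory Defs
  imports "HOL-Probability.Probability"
begin

text \<open>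
  The space $\mathbb{R}^J$ for a finite index set \<open>J\<close> is \<open>J \<rightarrow>\<^sub>E UNIV\<close> with topology \<open>powertop_real J\<close>.
  Index sets rather than index types are used so that a family of models may have a different
  dimension for each member.
\<close>

section \<open>Smoothness\<close>

text \<open>
  $C^\infty$ on a set that is open in $\mathbb{R}^J$. The function \<open>D [j1, ..., jn]\<close> is the iterated
  partial derivative of \<open>f\<close>, with \<open>j1\<close> the direction differentiated last.
\<close>

definition smooth_on_params :: "'j set \<Rightarrow> ('j \<Rightarrow> real) set \<Rightarrow> (('j \<Rightarrow> real) \<Rightarrow> real) \<Rightarrow> bool" where
  "smooth_on_params J \<Theta> f \<longleftrightarrow>
     (\<exists>D :: 'j list \<Rightarrow> ('j \<Rightarrow> real) \<Rightarrow> real.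
        (\<forall>\<theta>\<in>\<Theta>. D [] \<theta> = f \<theta>) \<and>
        (\<forall>js\<in>lists J.
           continuous_map (subtopology (powertop_real J) \<Theta>) euclideanreal (D js) \<and>
           (\<forall>j\<in>J. \<forall>\<theta>\<in>\<Theta>.
              ((\<lambda>t. D js (\<theta>(j := t))) has_real_derivative D (j # js) \<theta>) (at (\<theta> j)))))"

text \<open>$C^\infty$ on a closed interval, with one-sided derivatives at the end points.\<close>

definition smooth_on_interval :: "real \<Rightarrow> real \<Rightarrow> (real \<Rightarrow> real) \<Rightarrow> bool" where
  "smooth_on_interval a b f \<longleftrightarrow>
     (\<exists>D :: nat \<Rightarrow> real \<Rightarrow> real.
        (\<forall>t\<in>{a..b}. D 0 t = f t) \<and>
        (\<forall>n. \<forall>t\<in>{a..b}. (D n has_real_derivative D (Suc n) t) (at t within {a..b})))"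

text \<open>
  Consecutive closed pieces share their breakpoint, so a piecewise smooth curve is continuous.
\<close>

definition piecewise_smooth_curve :: "'j set \<Rightarrow> (real \<Rightarrow> 'j \<Rightarrow> real) \<Rightarrow> bool" where
  "piecewise_smooth_curve J c \<longleftrightarrow>
     (\<exists>(N :: nat) (\<tau> :: nat \<Rightarrow> real). \<tau> 0 = 0 \<and> \<tau> N = 1 \<and>
        (\<forall>n<N. \<tau> n < \<tau> (Suc n) \<and>
           (\<forall>j\<in>J. smooth_on_interval (\<tau> n) (\<tau> (Suc n)) (\<lambda>t. c t j))))"

section \<open>Regular statistical models\<close>

text \<open>
  A model is given by the index set \<open>J\<close> of its parameters, the parameter set \<open>\<Theta>\<close>, the dominating
  measure \<open>M\<close> and the densities \<open>p \<theta>\<close> for \<open>\<theta> \<in> \<Theta>\<close>.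
\<close>

definition model_dist :: "'x measure \<Rightarrow> (('j \<Rightarrow> real) \<Rightarrow> 'x \<Rightarrow> real) \<Rightarrow> ('j \<Rightarrow> real) \<Rightarrow> 'x measure" where
  "model_dist M p \<theta> = density M (\<lambda>x. ennreal (p \<theta> x))"

text \<open>
  The \<open>j\<close>-th component of $\nabla_\theta \log p_\theta(x)$, set to zero where it does not exist. Existence
  is expressed through \<open>p\<close> and not \<open>ln \<circ> p\<close>, because \<open>ln 0 = 0\<close> would make the latter
  differentiable at spurious points. In a regular model the exceptional set has probability zero
  under $p_\theta$.
\<close>

definition score :: "(('j \<Rightarrow> real) \<Rightarrow> 'x \<Rightarrow> real) \<Rightarrow> 'j \<Rightarrow> ('j \<Rightarrow> real) \<Rightarrow> 'x \<Rightarrow> real" where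
  "score p j \<theta> x =
     (if 0 < p \<theta> x \<and> (\<lambda>t. p (\<theta>(j := t)) x) differentiable (at (\<theta> j))
      then deriv (\<lambda>t. ln (p (\<theta>(j := t)) x)) (\<theta> j) else 0)"

definition fisher_information ::
    "'x measure \<Rightarrow> (('j \<Rightarrow> real) \<Rightarrow> 'x \<Rightarrow> real) \<Rightarrow> ('j \<Rightarrow> real) \<Rightarrow> 'j \<Rightarrow> 'j \<Rightarrow> real" where
  "fisher_information M p \<theta> j l = (\<integral>x. score p j \<theta> x * score p l \<theta> x \<partial>model_dist M p \<theta>)"

locale regular_statistical_model = sigma_finite_measure M
  for J :: "'j set" and \<Theta> :: "('j \<Rightarrow> real) set" and M :: "'x measure"
    and p :: "('j \<Rightarrow> real) \<Rightarrow> 'x \<Rightarrow> real" +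
  assumes finite_params: "finite J"
    and open_params: "openin (powertop_real J) \<Theta>"
    and connected_params: "connectedin (powertop_real J) \<Theta>"
    and density_measurable: "\<And>\<theta>. \<theta> \<in> \<Theta> \<Longrightarrow> p \<theta> \<in> borel_measurable M"
    and density_nonneg: "\<And>\<theta> x. \<theta> \<in> \<Theta> \<Longrightarrow> x \<in> space M \<Longrightarrow> 0 \<le> p \<theta> x"
    and density_prob: "\<And>\<theta>. \<theta> \<in> \<Theta> \<Longrightarrow> prob_space (model_dist M p \<theta>)"
    and density_differentiable: "\<And>\<theta> j. \<theta> \<in> \<Theta> \<Longrightarrow> j \<in> J \<Longrightarrow>
          AE x in model_dist M p \<theta>. (\<lambda>t. p (\<theta>(j := t)) x) differentiable (at (\<theta> j))"
    and score_integrable: "\<And>\<theta> j. \<theta> \<in> \<Theta> \<Longrightarrow> j \<in> J \<Longrightarrow>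
          integrable (model_dist M p \<theta>) (score p j \<theta>)"
    and score_mean_zero: "\<And>\<theta> j. \<theta> \<in> \<Theta> \<Longrightarrow> j \<in> J \<Longrightarrow>
          (\<integral>x. score p j \<theta> x \<partial>model_dist M p \<theta>) = 0"
    and fisher_well_defined: "\<And>\<theta> j l. \<theta> \<in> \<Theta> \<Longrightarrow> j \<in> J \<Longrightarrow> l \<in> J \<Longrightarrow>
          integrable (model_dist M p \<theta>) (\<lambda>x. score p j \<theta> x * score p l \<theta> x)"
    and fisher_pos_def: "\<And>\<theta> v. \<theta> \<in> \<Theta> \<Longrightarrow> \<exists>j\<in>J. v j \<noteq> 0 \<Longrightarrow>
          0 < (\<Sum>j\<in>J. \<Sum>l\<in>J. v j * fisher_information M p \<theta> j l * v l)"
    and fisher_smooth: "\<And>j l. j \<in> J \<Longrightarrow> l \<in> J \<Longrightarrow>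
          smooth_on_params J \<Theta> (\<lambda>\<theta>. fisher_information M p \<theta> j l)"

section \<open>Fisher--Rao distance\<close>

text \<open>
  The velocity is unspecified at the end points and breakpoints of a curve, which does not affect
  the integral.
\<close>

definition fisher_length ::
    "'j set \<Rightarrow> 'x measure \<Rightarrow> (('j \<Rightarrow> real) \<Rightarrow> 'x \<Rightarrow> real) \<Rightarrow> (real \<Rightarrow> 'j \<Rightarrow> real) \<Rightarrow> real" where
  "fisher_length J M p c =
     integral {0..1} (\<lambda>t. sqrt (\<Sum>j\<in>J. \<Sum>l\<in>J.
       deriv (\<lambda>s. c s j) t * fisher_information M p (c t) j l * deriv (\<lambda>s. c s l) t))"

definition fisher_rao_dist ::
    "'j set \<Rightarrow> ('j \<Rightarrow> real) set \<Rightarrow> 'x measure \<Rightarrow> (('j \<Rightarrow> real) \<Rightarrow> 'x \<Rightarrow> real)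
       \<Rightarrow> ('j \<Rightarrow> real) \<Rightarrow> ('j \<Rightarrow> real) \<Rightarrow> real" where
  "fisher_rao_dist J \<Theta> M p \<theta>\<^sub>0 \<theta>\<^sub>1 =
     Inf {fisher_length J M p c | c.
            piecewise_smooth_curve J c \<and> c ` {0..1} \<subseteq> \<Theta> \<and> c 0 = \<theta>\<^sub>0 \<and> c 1 = \<theta>\<^sub>1}"

section \<open>Products of models\<close>

text \<open>
  The coordinate \<open>(i, j)\<close> of a product parameter is the \<open>j\<close>-th coordinate of the parameter of the
  \<open>i\<close>-th model; \<open>block m \<theta> i\<close> extracts the latter. A sample of the product is the tuple of the
  samples \<open>x i\<close>, so the product model lives on \<open>PiM {..<k} \<mu>\<close>.
\<close>

definition product_index :: "nat \<Rightarrow> (nat \<Rightarrow> nat) \<Rightarrow> (nat \<times> nat) set" where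
  "product_index k m = (SIGMA i:{..<k}. {..<m i})"

definition block :: "(nat \<Rightarrow> nat) \<Rightarrow> (nat \<times> nat \<Rightarrow> real) \<Rightarrow> nat \<Rightarrow> nat \<Rightarrow> real" where
  "block m \<theta> i = (\<lambda>j\<in>{..<m i}. \<theta> (i, j))"

definition product_params ::
    "nat \<Rightarrow> (nat \<Rightarrow> nat) \<Rightarrow> (nat \<Rightarrow> (nat \<Rightarrow> real) set) \<Rightarrow> (nat \<times> nat \<Rightarrow> real) set" where
  "product_params k m \<Theta> =
     {\<theta> \<in> product_index k m \<rightarrow>\<^sub>E UNIV. \<forall>i<k. block m \<theta> i \<in> \<Theta> i}"

definition product_density ::
    "nat \<Rightarrow> (nat \<Rightarrow> nat) \<Rightarrow> (nat \<Rightarrow> (nat \<Rightarrow> real) \<Rightarrow> 'x \<Rightarrow> real)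
       \<Rightarrow> (nat \<times> nat \<Rightarrow> real) \<Rightarrow> (nat \<Rightarrow> 'x) \<Rightarrow> real" where
  "product_density k m p \<theta> x = (\<Prod>i<k. p i (block m \<theta> i) (x i))"

end

theory Submission
  imports Defs
begin

text \<open>
  Independence and the vanishing mean of the scores make the Fisher information of the product
  block diagonal, so the speed of a product curve is the Euclidean norm of the speeds of its blocks.
  The lower bound is then Minkowski's inequality for integrals. For the upper bound, each factor
  has a curve of nearly minimal length traversed at nearly constant speed, and running these
  simultaneously gives a product curve of almost the right length. Since curves need only be
  piecewise smooth, piecewise linear changes of time suffice to make the speeds nearly constant.
\<close>

section \<open>Piecewise smooth curves\<close>

text \<open>Equality in Minkowski's inequality forces the factor speeds to be proportional at almost
  every time, so nearly shortest curves in the factors do not combine into a nearly shortest product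
  curve until their parametrisations are adjusted. Arc length is an awkward parameter for this: a
  piecewise smooth curve may stop, possibly infinitely often, and the inverse of its arc length
  function need not be smooth there. What the upper bound really needs is weaker, namely that on
  \<open>[0, 1]\<close> each factor moves at speed at most its distance plus a small slack; no lower
  bound on the speed is required. Two features of the definitions shape the details. The speed uses
  the two-sided \<open>deriv\<close>, which is unspecified at breakpoints and end points, so speed
  bounds are asserted only off finite sets. The infimum of an empty set of reals carries no
  information, so connectedness must first supply at least one curve between any two
  parameters.\<close>

lemma smooth_on_interval_subset:
  assumes "smooth_on_interval a b f" "a \<le> u" "v \<le> b"
  shows "smooth_on_interval u v f"
proof -
  obtain D where D: "\<forall>t\<in>{a..b}. D 0 t = f t"
    "\<forall>n. \<forall>t\<in>{a..b}. (D n has_real_derivative D (Suc n) t) (at t within {a..b})"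
    using assms(1) unfolding smooth_on_interval_def by blast
  have sub: "{u..v} \<subseteq> {a..b}" using assms(2,3) by auto
  have "\<forall>t\<in>{u..v}. D 0 t = f t"
    using D(1) sub by blast
  moreover have "\<forall>n. \<forall>t\<in>{u..v}. (D n has_real_derivative D (Suc n) t) (at t within {u..v})"
    using D(2) sub DERIV_subset by blast
  ultimately show ?thesis
    unfolding smooth_on_interval_def by blast
qed

lemma smooth_on_interval_cong:
  assumes "smooth_on_interval a b f" "\<And>t. t \<in> {a..b} \<Longrightarrow> g t = f t"
  shows "smooth_on_interval a b g"
  using assms unfolding smooth_on_interval_def by metis

lemma smooth_on_interval_affine:
  assumes "smooth_on_interval (r * u + s) (r * v + s) f" and r: "0 < r"
  shows "smooth_on_interval u v (\<lambda>t. f (r * t + s))"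
proof -
  let ?K = "{r * u + s..r * v + s}"
  obtain D where D: "\<forall>t\<in>?K. D 0 t = f t"
    "\<forall>n. \<forall>t\<in>?K. (D n has_real_derivative D (Suc n) t) (at t within ?K)"
    using assms(1) unfolding smooth_on_interval_def by blast
  have img: "(\<lambda>t. r * t + s) ` {u..v} \<subseteq> ?K"
    using r by (auto intro: mult_left_mono)
  let ?E = "\<lambda>n t. r ^ n * D n (r * t + s)"
  have "(?E n has_real_derivative ?E (Suc n) t) (at t within {u..v})" if "t \<in> {u..v}" for n t
  proof -
    have "(D n has_real_derivative D (Suc n) (r * t + s))
        (at (r * t + s) within (\<lambda>t. r * t + s) ` {u..v})"
      using D(2) img that DERIV_subset by blast
    moreover have "((\<lambda>t. r * t + s) has_real_derivative r) (at t within {u..v})"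
      by (auto intro!: derivative_eq_intros)
    ultimately have "((\<lambda>t. D n (r * t + s)) has_real_derivative D (Suc n) (r * t + s) * r)
        (at t within {u..v})"
      using DERIV_image_chain[of "D n" _ "\<lambda>t. r * t + s"] by (simp add: o_def)
    from DERIV_cmult[OF this, of "r ^ n"] show ?thesis
      by (simp add: mult_ac)
  qed
  moreover have "\<forall>t\<in>{u..v}. ?E 0 t = f (r * t + s)"
    using D(1) img by auto
  ultimately show ?thesis
    unfolding smooth_on_interval_def by (intro exI[of _ ?E]) auto
qed

lemma smooth_on_interval_linear: "smooth_on_interval a b (\<lambda>t. x + t * y)"
  unfolding smooth_on_interval_def
  by (rule exI[of _ "\<lambda>n t. if n = 0 then x + t * y else if n = 1 then y else 0"])
    (auto intro!: derivative_eq_intros)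

text \<open>The one-sided derivatives at the end points make \<open>f'\<close> continuous on the
  closed interval, while the two-sided derivative, to which \<open>deriv\<close> refers, is
  available only inside.\<close>

lemma smooth_on_interval_imp_C1:
  assumes "smooth_on_interval a b f"
  obtains f' where "continuous_on {a..b} f" "continuous_on {a..b} f'"
    "\<And>t. t \<in> {a<..<b} \<Longrightarrow> (f has_real_derivative f' t) (at t)"
proof -
  obtain D where D: "\<forall>t\<in>{a..b}. D 0 t = f t"
    "\<forall>n. \<forall>t\<in>{a..b}. (D n has_real_derivative D (Suc n) t) (at t within {a..b})"
    using assms unfolding smooth_on_interval_def by blast
  have cont: "continuous_on {a..b} (D n)" for n
    using D(2) DERIV_continuous continuous_on_eq_continuous_within by blast
  show ?thesis
  proof
    show "continuous_on {a..b} f"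
      using cont[of 0] D(1) by (metis continuous_on_cong)
    show "continuous_on {a..b} (D 1)" by (rule cont)
    fix t assume t: "t \<in> {a<..<b}"
    have "(D 0 has_real_derivative D 1 t) (at t within {a..b})"
      using D(2) t by (metis One_nat_def atLeastAtMost_iff greaterThanLessThan_iff less_imp_le)
    then have "(D 0 has_real_derivative D 1 t) (at t)"
      using t by (metis at_within_Icc_at greaterThanLessThan_iff)
    then show "(f has_real_derivative D 1 t) (at t)"
    proof (rule has_field_derivative_transform_within_open[where S="{a<..<b}"])
      show "D 0 x = f x" if "x \<in> {a<..<b}" for x using D(1) that by auto
    qed (use t in auto)
  qed
qed

text \<open>A finite exceptional set replaces the ordered list of breakpoints: common refinements
  become unions of sets, and a change of time acts on the set by taking images. The intervals
  between exceptional points are closed, so continuity at the breakpoints is retained.\<close>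

definition piecewise_smooth_on :: "real \<Rightarrow> real \<Rightarrow> 'j set \<Rightarrow> (real \<Rightarrow> 'j \<Rightarrow> real) \<Rightarrow> bool" where
  "piecewise_smooth_on a b J c \<longleftrightarrow>
     (\<exists>S. finite S \<and> (\<forall>u v. a \<le> u \<longrightarrow> u < v \<longrightarrow> v \<le> b \<longrightarrow> {u<..<v} \<inter> S = {} \<longrightarrow>
        (\<forall>j\<in>J. smooth_on_interval u v (\<lambda>t. c t j))))"

lemma increasing_steps_imp_le:
  fixes \<tau> :: "nat \<Rightarrow> real"
  assumes "\<And>n. n < N \<Longrightarrow> \<tau> n < \<tau> (Suc n)" "i \<le> l" "l \<le> N"
  shows "\<tau> i \<le> \<tau> l"
  using assms(2,3)
proof (induction l)
  case (Suc l)
  then show ?case using assms(1)[of l] by (cases "i = Suc l") auto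
qed auto

lemma piecewise_smooth_curve_imp_on:
  assumes "piecewise_smooth_curve J c"
  shows "piecewise_smooth_on 0 1 J c"
proof -
  obtain N \<tau> where \<tau>: "\<tau> 0 = 0" "\<tau> N = (1::real)" "\<And>n. n < N \<Longrightarrow> \<tau> n < \<tau> (Suc n)"
    and smooth: "\<And>n j. n < N \<Longrightarrow> j \<in> J \<Longrightarrow> smooth_on_interval (\<tau> n) (\<tau> (Suc n)) (\<lambda>t. c t j)"
    using assms unfolding piecewise_smooth_curve_def by metis
  have "smooth_on_interval u v (\<lambda>t. c t j)"
    if uv: "0 \<le> u" "u < v" "v \<le> 1" and disj: "{u<..<v} \<inter> \<tau> ` {..N} = {}" and j: "j \<in> J" for u v j
  proof -
    \<comment> \<open>The first breakpoint beyond \<open>u\<close>. It lies at or beyond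
      \<open>v\<close>, since no breakpoint is strictly between \<open>u\<close> and
      \<open>v\<close>, so the piece ending at it contains \<open>{u..v}\<close>.\<close>
    define n where "n = (LEAST n. u < \<tau> n)"
    have ex: "u < \<tau> N" using uv \<tau> by simp
    have n: "u < \<tau> n" unfolding n_def using ex by (rule LeastI)
    have nN: "n \<le> N" unfolding n_def using ex by (rule Least_le)
    have "n \<noteq> 0" using n uv \<tau>(1) by (metis less_le_not_le)
    then obtain l where l: "n = Suc l" by (cases n) auto
    have "\<not> u < \<tau> l" using not_less_Least[of l "\<lambda>n. u < \<tau> n"] l n_def by simp
    moreover have "v \<le> \<tau> n"
    proof (rule ccontr)
      assume "\<not> v \<le> \<tau> n"
      then have "\<tau> n \<in> {u<..<v} \<inter> \<tau> ` {..N}" using n nN by auto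
      then show False using disj by simp
    qed
    ultimately show ?thesis
      using smooth_on_interval_subset[OF smooth[of l j]] l nN j by simp
  qed
  then show ?thesis
    unfolding piecewise_smooth_on_def by (intro exI[of _ "\<tau> ` {..N}"] conjI allI impI ballI) simp_all
qed

lemma piecewise_smooth_on_imp_curve:
  assumes "piecewise_smooth_on 0 1 J c"
  shows "piecewise_smooth_curve J c"
proof -
  obtain S where S: "finite S" and smooth: "\<And>u v j. 0 \<le> u \<Longrightarrow> u < v \<Longrightarrow> v \<le> 1 \<Longrightarrow>
      {u<..<v} \<inter> S = {} \<Longrightarrow> j \<in> J \<Longrightarrow> smooth_on_interval u v (\<lambda>t. c t j)"
    using assms unfolding piecewise_smooth_on_def by metis
  \<comment> \<open>Adding 0 and 1 makes the list begin and end where a curve must. Sortedness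
    leaves no point of \<open>S\<close> strictly between consecutive entries, because such a point
    would itself be an entry.\<close>
  define L where "L = sorted_list_of_set ({0, 1} \<union> (S \<inter> {0..1}))"
  define N where "N = length L - 1"
  have set: "set L = {0, 1} \<union> (S \<inter> {0..1})"
    unfolding L_def using S by (subst set_sorted_list_of_set) auto
  have srt: "sorted L" and dst: "distinct L" unfolding L_def by auto
  have ne: "L \<noteq> []" using set by auto
  have len: "length L = Suc N" using ne N_def by (cases L) auto
  have step: "L ! n < L ! Suc n" if "n < N" for n
    using that len srt dst
    by (simp add: sorted_wrt_nth_less strict_sorted_iff)
  have range: "L ! n \<in> {0..1}" if "n \<le> N" for n
  proof -
    have "L ! n \<in> set L" using that len by auto
    then show ?thesis unfolding set by auto
  qed
  have mono: "L ! i \<le> L ! l" if "i \<le> l" "l \<le> N" for i l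
    using sorted_nth_mono[OF srt that(1)] that(2) len by simp
  have "0 \<in> set L" "1 \<in> set L" using set by auto
  then obtain a b where ab: "a \<le> N" "L ! a = 0" "b \<le> N" "L ! b = 1"
    using len by (metis in_set_conv_nth less_Suc_eq_le)
  have "L ! 0 = 0" using mono[of 0 a] range[of 0] ab by auto
  moreover have "L ! N = 1" using mono[of b N] range[of N] ab by auto
  moreover have "L ! n < L ! Suc n \<and> (\<forall>j\<in>J. smooth_on_interval (L ! n) (L ! Suc n) (\<lambda>t. c t j))"
    if n: "n < N" for n
  proof -
    have "{L ! n<..<L ! Suc n} \<inter> S = {}"
    proof safe
      fix x assume x: "x \<in> {L ! n<..<L ! Suc n}" "x \<in> S"
      then have "x \<in> set L" using range[of n] range[of "Suc n"] n set by auto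
      then obtain i where i: "i \<le> N" "L ! i = x"
        using len by (metis in_set_conv_nth less_Suc_eq_le)
      show "x \<in> {}"
      proof (cases "i \<le> n")
        case True
        then show ?thesis using mono[of i n] i n x by auto
      next
        case False
        then show ?thesis using mono[of "Suc n" i] i n x by auto
      qed
    qed
    then show ?thesis
      using smooth[of "L ! n" "L ! Suc n"] step[OF n] range[of n] range[of "Suc n"] n by auto
  qed
  ultimately show ?thesis
    unfolding piecewise_smooth_curve_def by (intro exI[of _ N] exI[of _ "(!) L"]) auto
qed

lemma gap_around_point:
  fixes a b t :: real
  assumes "finite S" "t \<in> {a<..<b} - S"
  obtains u v where "a \<le> u" "u < t" "t < v" "v \<le> b" "{u<..<v} \<inter> S = {}"
proof -
  have "open ({a<..<b} - S)" using assms(1) by (simp add: finite_imp_closed open_Diff)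
  then obtain e where e: "e > 0" "\<And>y. dist y t < e \<Longrightarrow> y \<in> {a<..<b} - S"
    using assms(2) unfolding open_dist by blast
  have in_ab: "x \<in> {a<..<b} - S" if "x \<in> {t - e/2..t + e/2}" for x
    using that e by (auto simp: dist_real_def abs_if split: if_splits)
  have "t - e/2 \<in> {a<..<b}" "t + e/2 \<in> {a<..<b}"
    using in_ab[of "t - e/2"] in_ab[of "t + e/2"] e(1) by simp_all
  moreover have "{t - e/2<..<t + e/2} \<inter> S = {}"
    using in_ab by fastforce
  ultimately show ?thesis
    using e(1) by (intro that[of "t - e/2" "t + e/2"]) auto
qed

lemma piecewise_smooth_on_differentiable:
  assumes "piecewise_smooth_on a b J c"
  obtains S where "finite S"
    "\<And>t j. t \<in> {a<..<b} - S \<Longrightarrow> j \<in> J \<Longrightarrow> (\<lambda>s. c s j) differentiable at t"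
proof -
  obtain S where S: "finite S" and smooth: "\<And>u v j. a \<le> u \<Longrightarrow> u < v \<Longrightarrow> v \<le> b \<Longrightarrow>
      {u<..<v} \<inter> S = {} \<Longrightarrow> j \<in> J \<Longrightarrow> smooth_on_interval u v (\<lambda>t. c t j)"
    using assms unfolding piecewise_smooth_on_def by metis
  have "(\<lambda>s. c s j) differentiable at t" if t: "t \<in> {a<..<b} - S" and j: "j \<in> J" for t j
  proof -
    obtain u v where uv: "a \<le> u" "u < t" "t < v" "v \<le> b" "{u<..<v} \<inter> S = {}"
      by (rule gap_around_point[OF S t])
    then have "smooth_on_interval u v (\<lambda>s. c s j)" using smooth j by auto
    then obtain f' where "\<And>t. t \<in> {u<..<v} \<Longrightarrow> ((\<lambda>s. c s j) has_real_derivative f' t) (at t)"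
      by (rule smooth_on_interval_imp_C1) blast
    then show ?thesis using uv real_differentiable_def by fastforce
  qed
  with S show ?thesis by (rule that)
qed

lemma piecewise_smooth_on_cong:
  assumes "piecewise_smooth_on a b J c" "\<And>t j. t \<in> {a..b} \<Longrightarrow> j \<in> J \<Longrightarrow> c' t j = c t j"
  shows "piecewise_smooth_on a b J c'"
proof -
  obtain S where S: "finite S" and smooth: "\<And>u v j. a \<le> u \<Longrightarrow> u < v \<Longrightarrow> v \<le> b \<Longrightarrow>
      {u<..<v} \<inter> S = {} \<Longrightarrow> j \<in> J \<Longrightarrow> smooth_on_interval u v (\<lambda>t. c t j)"
    using assms(1) unfolding piecewise_smooth_on_def by metis
  have "smooth_on_interval u v (\<lambda>t. c' t j)"
    if "a \<le> u" "u < v" "v \<le> b" "{u<..<v} \<inter> S = {}" "j \<in> J" for u v j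
    using smooth[OF that] by (rule smooth_on_interval_cong) (use that assms(2) in auto)
  then show ?thesis using S unfolding piecewise_smooth_on_def by blast
qed

lemma piecewise_smooth_on_affine:
  assumes "piecewise_smooth_on (r * a + s) (r * b + s) J c" and r: "0 < r"
  shows "piecewise_smooth_on a b J (\<lambda>t. c (r * t + s))"
proof -
  obtain S where S: "finite S" and smooth: "\<And>u v j. r * a + s \<le> u \<Longrightarrow> u < v \<Longrightarrow> v \<le> r * b + s \<Longrightarrow>
      {u<..<v} \<inter> S = {} \<Longrightarrow> j \<in> J \<Longrightarrow> smooth_on_interval u v (\<lambda>t. c t j)"
    using assms(1) unfolding piecewise_smooth_on_def by metis
  let ?S = "(\<lambda>x. (x - s) / r) ` S"
  have "smooth_on_interval u v (\<lambda>t. c (r * t + s) j)"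
    if "a \<le> u" "u < v" "v \<le> b" "{u<..<v} \<inter> ?S = {}" "j \<in> J" for u v j
  proof (rule smooth_on_interval_affine[OF smooth r])
    show "{r * u + s<..<r * v + s} \<inter> S = {}"
    proof safe
      fix x assume x: "x \<in> {r * u + s<..<r * v + s}" "x \<in> S"
      then have "(x - s) / r \<in> {u<..<v} \<inter> ?S"
        using r by (auto simp: field_simps)
      then show "x \<in> {}" using that(4) by simp
    qed
  qed (use that r in auto)
  then show ?thesis using S unfolding piecewise_smooth_on_def by (intro exI[of _ ?S]) auto
qed

text \<open>With the junction \<open>b\<close> declared exceptional, every interval to be tested
  lies on one side of it.\<close>

lemma piecewise_smooth_on_join:
  assumes "piecewise_smooth_on a b J c" "piecewise_smooth_on b d J c"
  shows "piecewise_smooth_on a d J c"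
proof -
  obtain S where S: "finite S" and smooth: "\<And>u v j. a \<le> u \<Longrightarrow> u < v \<Longrightarrow> v \<le> b \<Longrightarrow>
      {u<..<v} \<inter> S = {} \<Longrightarrow> j \<in> J \<Longrightarrow> smooth_on_interval u v (\<lambda>t. c t j)"
    using assms(1) unfolding piecewise_smooth_on_def by metis
  obtain S' where S': "finite S'" and smooth': "\<And>u v j. b \<le> u \<Longrightarrow> u < v \<Longrightarrow> v \<le> d \<Longrightarrow>
      {u<..<v} \<inter> S' = {} \<Longrightarrow> j \<in> J \<Longrightarrow> smooth_on_interval u v (\<lambda>t. c t j)"
    using assms(2) unfolding piecewise_smooth_on_def by metis
  have "smooth_on_interval u v (\<lambda>t. c t j)"
    if uv: "a \<le> u" "u < v" "v \<le> d" and disj: "{u<..<v} \<inter> (insert b (S \<union> S')) = {}"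
      and j: "j \<in> J" for u v j
  proof -
    have "b \<notin> {u<..<v}" using disj by blast
    then consider "v \<le> b" | "b \<le> u" using uv by fastforce
    then show ?thesis
    proof cases
      case 1
      then show ?thesis using smooth uv disj j by auto
    next
      case 2
      then show ?thesis using smooth' uv disj j by auto
    qed
  qed
  moreover have "finite (insert b (S \<union> S'))" using S S' by simp
  ultimately show ?thesis unfolding piecewise_smooth_on_def by blast
qed

lemma smooth_imp_piecewise_smooth_on:
  assumes "\<And>j. j \<in> J \<Longrightarrow> smooth_on_interval a b (\<lambda>t. c t j)"
  shows "piecewise_smooth_on a b J c"
  unfolding piecewise_smooth_on_def
  by (rule exI[of _ "{}"]) (auto intro: smooth_on_interval_subset[OF assms])

section \<open>Length and travel time\<close>

definition quadratic_form :: "'j set \<Rightarrow> ('j \<Rightarrow> 'j \<Rightarrow> real) \<Rightarrow> ('j \<Rightarrow> real) \<Rightarrow> real" where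
  "quadratic_form J A v = (\<Sum>j\<in>J. \<Sum>l\<in>J. v j * A j l * v l)"

lemma quadratic_form_scale: "quadratic_form J A (\<lambda>j. r * v j) = r\<^sup>2 * quadratic_form J A v"
  unfolding quadratic_form_def
  by (simp add: sum_distrib_left power2_eq_square mult_ac)

lemma quadratic_form_cong:
  assumes "\<And>j. j \<in> J \<Longrightarrow> v j = w j"
  shows "quadratic_form J A v = quadratic_form J A w"
  unfolding quadratic_form_def using assms by (intro sum.cong) auto

definition curve_speed ::
    "'j set \<Rightarrow> (('j \<Rightarrow> real) \<Rightarrow> 'j \<Rightarrow> 'j \<Rightarrow> real) \<Rightarrow> (real \<Rightarrow> 'j \<Rightarrow> real) \<Rightarrow> real \<Rightarrow> real" where
  "curve_speed J g c t = sqrt (quadratic_form J (g (c t)) (\<lambda>j. deriv (\<lambda>s. c s j) t))"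

lemma curve_speed_cong:
  assumes "open U" "t \<in> U" "\<And>s. s \<in> U \<Longrightarrow> c s = c' s"
  shows "curve_speed J g c t = curve_speed J g c' t"
proof -
  have "\<forall>\<^sub>F s in nhds t. s \<in> U" using assms by (simp add: eventually_nhds_in_open)
  then have "\<forall>\<^sub>F s in nhds t. c s j = c' s j" for j
    by eventually_elim (simp add: assms(3))
  then have "deriv (\<lambda>s. c s j) t = deriv (\<lambda>s. c' s j) t" for j
    by (intro deriv_cong_ev) auto
  then show ?thesis using assms by (simp add: curve_speed_def)
qed

text \<open>Chain rule and homogeneity of the quadratic form. Differentiability is assumed because
  \<open>deriv\<close> is otherwise unspecified and need not scale, and \<open>0 \<le> r\<close>
  turns the square root of \<open>r\<^sup>2\<close> into \<open>r\<close>.\<close>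

lemma curve_speed_affine:
  assumes "\<And>j. j \<in> J \<Longrightarrow> (\<lambda>s. c s j) differentiable at (r * t + s)" and r: "0 \<le> r"
  shows "curve_speed J g (\<lambda>t. c (r * t + s)) t = r * curve_speed J g c (r * t + s)"
proof -
  have "deriv (\<lambda>t. c (r * t + s) j) t = r * deriv (\<lambda>s. c s j) (r * t + s)" if j: "j \<in> J" for j
  proof -
    have "((\<lambda>s. c s j) has_real_derivative deriv (\<lambda>s. c s j) (r * t + s)) (at (r * t + s))"
      using assms(1)[OF j] DERIV_deriv_iff_real_differentiable by blast
    moreover have "((\<lambda>t. r * t + s) has_real_derivative r) (at t)"
      by (auto intro!: derivative_eq_intros)
    ultimately have "((\<lambda>t. c (r * t + s) j) has_real_derivative
        deriv (\<lambda>s. c s j) (r * t + s) * r) (at t)"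
      by (rule DERIV_chain2)
    then show ?thesis by (simp add: DERIV_imp_deriv)
  qed
  then have "quadratic_form J (g (c (r * t + s))) (\<lambda>j. deriv (\<lambda>t. c (r * t + s) j) t)
     = quadratic_form J (g (c (r * t + s))) (\<lambda>j. r * deriv (\<lambda>s. c s j) (r * t + s))"
    by (rule quadratic_form_cong)
  then show ?thesis
    using r by (simp add: curve_speed_def quadratic_form_scale real_sqrt_mult)
qed

text \<open>A common setting for the factors, with \<open>g\<close> in the role of the Fisher
  matrix. Nonnegativity makes the speed nonnegative, continuity makes it continuous along smooth
  pieces, and openness with connectedness provides curves between any two parameters.\<close>

locale param_metric =
  fixes J :: "'j set" and \<Theta> :: "('j \<Rightarrow> real) set"
    and g :: "('j \<Rightarrow> real) \<Rightarrow> 'j \<Rightarrow> 'j \<Rightarrow> real"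
  assumes finite_J: "finite J"
    and open_\<Theta>: "openin (powertop_real J) \<Theta>"
    and connected_\<Theta>: "connectedin (powertop_real J) \<Theta>"
    and nonneg: "\<And>\<theta> v. \<theta> \<in> \<Theta> \<Longrightarrow> 0 \<le> quadratic_form J (g \<theta>) v"
    and cont: "\<And>j l. j \<in> J \<Longrightarrow> l \<in> J \<Longrightarrow>
      continuous_map (subtopology (powertop_real J) \<Theta>) euclideanreal (\<lambda>\<theta>. g \<theta> j l)"
begin

lemma params_extensional: "\<theta> \<in> \<Theta> \<Longrightarrow> \<theta> \<in> extensional J"
  using openin_subset[OF open_\<Theta>] by (auto simp: PiE_def)

lemma speed_nonneg: "c t \<in> \<Theta> \<Longrightarrow> 0 \<le> curve_speed J g c t"
  by (simp add: curve_speed_def nonneg)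

text \<open>At the end points \<open>curve_speed\<close> involves unspecified derivatives;
  \<open>f\<close> is the same expression with the one-sided derivatives instead. Continuity up to
  the ends gives integrability and the local estimates on which the bisection rests.\<close>

lemma speed_on_smooth_piece:
  assumes smooth: "\<And>j. j \<in> J \<Longrightarrow> smooth_on_interval a b (\<lambda>t. c t j)"
    and im: "c ` {a..b} \<subseteq> \<Theta>"
  obtains f where "continuous_on {a..b} f" "\<And>t. t \<in> {a<..<b} \<Longrightarrow> curve_speed J g c t = f t"
    "\<And>t. t \<in> {a..b} \<Longrightarrow> 0 \<le> f t"
proof -
  have "\<exists>f'. continuous_on {a..b} (\<lambda>t. c t j) \<and> continuous_on {a..b} f' \<and>
     (\<forall>t\<in>{a<..<b}. ((\<lambda>t. c t j) has_real_derivative f' t) (at t))" if "j \<in> J" for j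
    using smooth[OF that] by (rule smooth_on_interval_imp_C1) blast
  then obtain c' where cc: "\<And>j. j \<in> J \<Longrightarrow> continuous_on {a..b} (\<lambda>t. c t j)"
    and cc': "\<And>j. j \<in> J \<Longrightarrow> continuous_on {a..b} (c' j)"
    and der: "\<And>j t. j \<in> J \<Longrightarrow> t \<in> {a<..<b} \<Longrightarrow> ((\<lambda>t. c t j) has_real_derivative c' j t) (at t)"
    by metis
  have "continuous_map (top_of_set {a..b}) (subtopology (powertop_real J) \<Theta>) c"
    using im cc params_extensional
    by (auto simp: continuous_map_in_subtopology continuous_map_componentwise image_subset_iff
        continuous_map_iff_continuous)
  then have gc: "continuous_on {a..b} (\<lambda>t. g (c t) j l)" if "j \<in> J" "l \<in> J" for j l
    using continuous_map_compose[OF _ cont[OF that]] by (force simp: o_def)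
  let ?f = "\<lambda>t. sqrt (quadratic_form J (g (c t)) (\<lambda>j. c' j t))"
  show ?thesis
  proof
    show "continuous_on {a..b} ?f"
      unfolding quadratic_form_def using finite_J gc cc' by (intro continuous_intros) auto
    fix t assume "t \<in> {a<..<b}"
    then have "deriv (\<lambda>t. c t j) t = c' j t" if "j \<in> J" for j
      using der that DERIV_imp_deriv by blast
    then show "curve_speed J g c t = ?f t"
      unfolding curve_speed_def by (simp cong: quadratic_form_cong)
  next
    fix t assume "t \<in> {a..b}"
    then have "c t \<in> \<Theta>" using im by auto
    then show "0 \<le> ?f t" by (simp add: nonneg)
  qed
qed

text \<open>Travel times at speed at most one add up along concatenations, so that no reparametrisation
  has to be written down explicitly.\<close>

definition reaches :: "('j \<Rightarrow> real) \<Rightarrow> ('j \<Rightarrow> real) \<Rightarrow> real \<Rightarrow> bool" where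
  "reaches x y T \<longleftrightarrow> 0 < T \<and> (\<exists>c. piecewise_smooth_on 0 T J c \<and> c ` {0..T} \<subseteq> \<Theta> \<and> c 0 = x \<and> c T = y \<and>
     (\<exists>S. finite S \<and> (\<forall>t\<in>{0<..<T} - S. curve_speed J g c t \<le> 1)))"

lemma reaches_trans:
  assumes "reaches x y T" "reaches y z T'"
  shows "reaches x z (T + T')"
proof -
  obtain c S where T: "0 < T" and c: "piecewise_smooth_on 0 T J c" "c ` {0..T} \<subseteq> \<Theta>" "c 0 = x" "c T = y"
    and S: "finite S" "\<And>t. t \<in> {0<..<T} - S \<Longrightarrow> curve_speed J g c t \<le> 1"
    using assms(1) unfolding reaches_def by blast
  obtain c' S' where T': "0 < T'" and c': "piecewise_smooth_on 0 T' J c'" "c' ` {0..T'} \<subseteq> \<Theta>"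
      "c' 0 = y" "c' T' = z"
    and S': "finite S'" "\<And>t. t \<in> {0<..<T'} - S' \<Longrightarrow> curve_speed J g c' t \<le> 1"
    using assms(2) unfolding reaches_def by blast
  define d where "d = (\<lambda>t. if t \<le> T then c t else c' (t - T))"
  \<comment> \<open>The second formula is valid at \<open>t = T\<close> too, because
    \<open>c T = y = c' 0\<close>. The closed piece starting at \<open>T\<close> needs this.\<close>
  have d': "d t = c' (t - T)" if "T \<le> t" for t
    using that c(4) c'(3) by (cases "t = T") (auto simp: d_def)
  have "piecewise_smooth_on 0 T J d"
    using c(1) by (rule piecewise_smooth_on_cong) (auto simp: d_def)
  moreover have "piecewise_smooth_on T (T + T') J d"
  proof (rule piecewise_smooth_on_cong)
    show "piecewise_smooth_on T (T + T') J (\<lambda>t. c' (1 * t + (- T)))"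
      by (rule piecewise_smooth_on_affine) (use c'(1) in simp_all)
  qed (auto simp: d')
  ultimately have "piecewise_smooth_on 0 (T + T') J d"
    by (rule piecewise_smooth_on_join)
  moreover have "d ` {0..T + T'} \<subseteq> \<Theta>"
  proof safe
    fix t assume t: "t \<in> {0..T + T'}"
    show "d t \<in> \<Theta>"
      using t c(2) c'(2) d'[of t] by (cases "t \<le> T") (auto simp: d_def image_subset_iff)
  qed
  moreover obtain R where R: "finite R" "\<And>t j. t \<in> {0<..<T'} - R \<Longrightarrow> j \<in> J \<Longrightarrow> (\<lambda>s. c' s j) differentiable at t"
    by (rule piecewise_smooth_on_differentiable[OF c'(1)]) blast
  \<comment> \<open>Besides the exceptional times of both curves, the junction is excluded, where
    the two velocities need not match, and so are the shifted times in \<open>R\<close>, where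
    \<open>curve_speed_affine\<close> could not be applied.\<close>
  define Q where "Q = insert T (S \<union> (\<lambda>t. t + T) ` (S' \<union> R))"
  have "curve_speed J g d t \<le> 1" if t: "t \<in> {0<..<T + T'} - Q" for t
  proof -
    consider "t < T" | "T < t" using t by (force simp: Q_def)
    then show ?thesis
    proof cases
      case 1
      have "curve_speed J g d t = curve_speed J g c t"
        by (rule curve_speed_cong[of "{..<T}"]) (use 1 in \<open>auto simp: d_def\<close>)
      then show ?thesis using S(2)[of t] t 1 by (auto simp: Q_def)
    next
      case 2
      have notin: "t - T \<notin> S' \<union> R"
      proof
        assume "t - T \<in> S' \<union> R"
        then have "(t - T) + T \<in> Q" unfolding Q_def by blast
        then show False using t by simp
      qed
      have "curve_speed J g d t = curve_speed J g (\<lambda>t. c' (1 * t + (- T))) t"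
        by (rule curve_speed_cong[of "{T<..}"]) (use 2 in \<open>auto simp: d'\<close>)
      also have "\<dots> = 1 * curve_speed J g c' (1 * t + (- T))"
        by (rule curve_speed_affine) (use R(2) notin t 2 in auto)
      finally show ?thesis using S'(2)[of "t - T"] t 2 notin by auto
    qed
  qed
  moreover have "finite Q" unfolding Q_def using S S' R by simp
  moreover have "d 0 = x" "d (T + T') = z" using T T' c c' by (auto simp: d_def)
  ultimately show ?thesis using T T' unfolding reaches_def by (intro conjI exI[of _ d]) auto
qed

lemma reaches_refl:
  assumes "x \<in> \<Theta>" "0 < T"
  shows "reaches x x T"
proof -
  have "piecewise_smooth_on 0 T J (\<lambda>_. x)"
    using smooth_on_interval_linear[of 0 T _ 0] by (intro smooth_imp_piecewise_smooth_on) simp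
  moreover have "curve_speed J g (\<lambda>_. x) t \<le> 1" for t
    by (simp add: curve_speed_def quadratic_form_def)
  ultimately show ?thesis using assms unfolding reaches_def by (intro conjI exI[of _ "\<lambda>_. x"]) auto
qed

text \<open>Running the curve at rate \<open>inverse M\<close> divides its speed by \<open>M\<close>
  and multiplies its duration by \<open>M\<close>.\<close>

lemma reaches_rescale:
  assumes c: "piecewise_smooth_on a b J c" "c ` {a..b} \<subseteq> \<Theta>" "a < b" and M: "0 < M"
    and S: "finite S" "\<And>t. t \<in> {a<..<b} - S \<Longrightarrow> curve_speed J g c t \<le> M"
  shows "reaches (c a) (c b) (M * (b - a))"
proof -
  let ?T = "M * (b - a)"
  let ?d = "\<lambda>t. c (inverse M * t + a)"
  obtain R where R: "finite R" "\<And>t j. t \<in> {a<..<b} - R \<Longrightarrow> j \<in> J \<Longrightarrow> (\<lambda>s. c s j) differentiable at t"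
    by (rule piecewise_smooth_on_differentiable[OF c(1)]) blast
  have T: "0 < ?T" using c(3) M by simp
  have "piecewise_smooth_on 0 ?T J ?d"
    by (rule piecewise_smooth_on_affine) (use c(1) M in \<open>simp_all add: field_simps\<close>)
  moreover have "?d ` {0..?T} \<subseteq> \<Theta>"
  proof safe
    fix t assume "t \<in> {0..?T}"
    then have "inverse M * t + a \<in> {a..b}" using M by (simp add: field_simps)
    then show "?d t \<in> \<Theta>" using c(2) by blast
  qed
  moreover define Q where "Q = (\<lambda>t. M * (t - a)) ` (S \<union> R)"
  have "curve_speed J g ?d t \<le> 1" if t: "t \<in> {0<..<?T} - Q" for t
  proof -
    let ?t = "inverse M * t + a"
    have "?t \<notin> S \<union> R"
    proof
      assume "?t \<in> S \<union> R"
      then have "M * (?t - a) \<in> Q" unfolding Q_def by blast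
      moreover have "M * (?t - a) = t" using M by simp
      ultimately show False using t by (metis DiffD2)
    qed
    moreover have "?t \<in> {a<..<b}" using t M by (simp add: field_simps)
    ultimately have t': "?t \<in> {a<..<b} - S" "?t \<in> {a<..<b} - R" by auto
    have "curve_speed J g ?d t = inverse M * curve_speed J g c ?t"
      by (rule curve_speed_affine) (use R(2)[OF t'(2)] M in auto)
    also have "\<dots> \<le> inverse M * M"
      using S(2)[OF t'(1)] M by (intro mult_left_mono) auto
    finally show ?thesis using M by simp
  qed
  moreover have "finite Q" unfolding Q_def using S R by simp
  moreover have "?d ?T = c b" using M by (simp add: field_simps)
  ultimately show ?thesis using T unfolding reaches_def by (intro conjI exI[of _ ?d]) auto
qed

text \<open>The converse rescaling: compressing a journey of duration \<open>T\<close> to the unit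
  interval turns the travel time into a speed bound. In this way curves of different factors come to
  share one time interval.\<close>

lemma reaches_imp_curve:
  assumes "reaches x y T"
  obtains c S where "piecewise_smooth_curve J c" "c ` {0..1} \<subseteq> \<Theta>" "c 0 = x" "c 1 = y" "finite S"
    "\<And>t. t \<in> {0<..<1} - S \<Longrightarrow> curve_speed J g c t \<le> T"
proof -
  obtain c S where T: "0 < T" and c: "piecewise_smooth_on 0 T J c" "c ` {0..T} \<subseteq> \<Theta>" "c 0 = x" "c T = y"
    and S: "finite S" "\<And>t. t \<in> {0<..<T} - S \<Longrightarrow> curve_speed J g c t \<le> 1"
    using assms(1) unfolding reaches_def by blast
  obtain R where R: "finite R" "\<And>t j. t \<in> {0<..<T} - R \<Longrightarrow> j \<in> J \<Longrightarrow> (\<lambda>s. c s j) differentiable at t"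
    by (rule piecewise_smooth_on_differentiable[OF c(1)]) blast
  let ?d = "\<lambda>t. c (T * t + 0)"
  define Q where "Q = (\<lambda>t. t / T) ` (S \<union> R)"
  show ?thesis
  proof
    show "piecewise_smooth_curve J ?d"
      by (rule piecewise_smooth_on_imp_curve, rule piecewise_smooth_on_affine) (use c(1) T in auto)
    show "?d ` {0..1} \<subseteq> \<Theta>"
    proof safe
      fix t :: real assume "t \<in> {0..1}"
      then have "T * t + 0 \<in> {0..T}" using T by (simp add: mult_le_cancel_left1)
      then show "?d t \<in> \<Theta>" using c(2) by blast
    qed
    show "finite Q" unfolding Q_def using S R by simp
    show "?d 0 = x" "?d 1 = y" using c by auto
    fix t assume t: "t \<in> {0<..<1} - Q"
    have "T * t + 0 \<notin> S \<union> R"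
    proof
      assume "T * t + 0 \<in> S \<union> R"
      then have "(T * t + 0) / T \<in> Q" unfolding Q_def by blast
      then show False using t T by simp
    qed
    moreover have "T * t + 0 \<in> {0<..<T}" using t T by simp
    ultimately have t': "T * t + 0 \<in> {0<..<T} - S" "T * t + 0 \<in> {0<..<T} - R" by auto
    have "curve_speed J g ?d t = T * curve_speed J g c (T * t + 0)"
      by (rule curve_speed_affine) (use R(2)[OF t'(2)] T in auto)
    with S(2)[OF t'(1)] show "curve_speed J g ?d t \<le> T" using T by simp
  qed
qed

text \<open>Bisection replaces the reparametrisation by arc length: on a short interval the speed is almost
  constant, so it may be replaced by its upper bound there.\<close>

lemma smooth_piece_reaches:
  assumes smooth: "\<And>j. j \<in> J \<Longrightarrow> smooth_on_interval a b (\<lambda>t. c t j)"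
    and im: "c ` {a..b} \<subseteq> \<Theta>" and ab: "a < b" and \<delta>: "0 < \<delta>"
  shows "curve_speed J g c integrable_on {a..b}"
    and "reaches (c a) (c b) (integral {a..b} (curve_speed J g c) + \<delta> * (b - a))"
proof -
  obtain f where f: "continuous_on {a..b} f" "\<And>t. t \<in> {a<..<b} \<Longrightarrow> curve_speed J g c t = f t"
      "\<And>t. t \<in> {a..b} \<Longrightarrow> 0 \<le> f t"
    using speed_on_smooth_piece[OF smooth im] by metis
  have fint: "f integrable_on {u..v}" if "a \<le> u" "v \<le> b" for u v
    using continuous_on_subset[OF f(1)] that by (intro integrable_continuous_real) auto
  \<comment> \<open>The two integrands can differ only at the end points, which does not change the
    integral.\<close>
  have "(curve_speed J g c has_integral integral {a..b} f) (cbox a b)"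
  proof (rule has_integral_spike_interior)
    show "(f has_integral integral {a..b} f) (cbox a b)"
      using fint[of a b] by (simp add: has_integral_integral)
  qed (use f(2) in auto)
  then have eq: "integral {a..b} f = integral {a..b} (curve_speed J g c)"
    and "curve_speed J g c integrable_on {a..b}"
    by (auto simp: integral_unique)
  then show "curve_speed J g c integrable_on {a..b}" by simp
  \<comment> \<open>Both summands of the time are additive over adjacent intervals, so concatenation
    loses nothing and the total slack stays \<open>\<delta> * (b - a)\<close> however fine the
    subdivision is. Degenerate intervals are exempt because travel times are positive.\<close>
  define P where "P u v \<longleftrightarrow> (a \<le> u \<and> u < v \<and> v \<le> b \<longrightarrow>
    reaches (c u) (c v) (integral {u..v} f + \<delta> * (v - u)))" for u v
  have "a \<le> b" using ab by simp
  then have "P a b"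
  proof (induction rule: Bolzano)
    case (trans u v w)
    show ?case
    proof (cases "a \<le> u \<and> u < w \<and> w \<le> b \<and> u < v \<and> v < w")
      case True
      then have "reaches (c u) (c v) (integral {u..v} f + \<delta> * (v - u))"
        "reaches (c v) (c w) (integral {v..w} f + \<delta> * (w - v))"
        using trans unfolding P_def by auto
      from reaches_trans[OF this]
      have "reaches (c u) (c w) (integral {u..v} f + \<delta> * (v - u) + (integral {v..w} f + \<delta> * (w - v)))" .
      moreover have "integral {u..v} f + integral {v..w} f = integral {u..w} f"
        using True fint by (intro Henstock_Kurzweil_Integration.integral_combine) auto
      ultimately show ?thesis unfolding P_def by (simp add: algebra_simps)
    next
      case False
      then show ?thesis
        using trans unfolding P_def by (cases "u = v"; cases "v = w"; auto)
    qed
  next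
    case (local x)
    then obtain d where d: "0 < d" "\<And>t. t \<in> {a..b} \<Longrightarrow> dist t x < d \<Longrightarrow> dist (f t) (f x) < \<delta> / 2"
      using f(1) \<delta> unfolding continuous_on_iff by (metis atLeastAtMost_iff half_gt_zero)
    have "P u v" if uv: "u \<le> x" "x \<le> v" "v - u < d" for u v
      unfolding P_def
    proof
      assume *: "a \<le> u \<and> u < v \<and> v \<le> b"
      have near: "\<bar>f t - f x\<bar> \<le> \<delta> / 2" if "t \<in> {u..v}" for t
      proof -
        have "\<bar>t - x\<bar> < d" using that uv by (simp add: abs_if)
        then show ?thesis using d(2)[of t] that * by (simp add: dist_real_def)
      qed
      have fx: "0 \<le> f x" using f(3) local by simp
      \<comment> \<open>The mean speed plus \<open>\<delta>\<close>. The mean is at least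
        \<open>f x - \<delta> / 2\<close>, so \<open>M\<close> is at least
        \<open>f x + \<delta> / 2\<close>, which dominates \<open>f\<close> on the whole short
        interval. It is positive even where the curve stands still, and \<open>M * (v - u)\<close>
        is exactly the time allowed.\<close>
      define M where "M = integral {u..v} f / (v - u) + \<delta>"
      have "integral {u..v} (\<lambda>_. f x - \<delta> / 2) \<le> integral {u..v} f"
      proof (rule integral_le)
        show "f x - \<delta> / 2 \<le> f t" if "t \<in> {u..v}" for t
          using near[OF that] by linarith
      qed (use fint[of u v] * in auto)
      then have M: "f x + \<delta> / 2 \<le> M" "M * (v - u) = integral {u..v} f + \<delta> * (v - u)"
        using * by (simp_all add: M_def field_simps)
      have "reaches (c u) (c v) (M * (v - u))"
      proof (rule reaches_rescale)
        show "piecewise_smooth_on u v J c"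
          using smooth_on_interval_subset[OF smooth] * by (intro smooth_imp_piecewise_smooth_on) simp
        show "c ` {u..v} \<subseteq> \<Theta>" using im * by auto
        show "u < v" using * by simp
        show "0 < M" using M(1) fx \<delta> by linarith
        show "finite {}" by simp
        show "curve_speed J g c t \<le> M" if "t \<in> {u<..<v} - {}" for t
        proof -
          have "\<bar>f t - f x\<bar> \<le> \<delta> / 2" "curve_speed J g c t = f t"
            using near[of t] f(2)[of t] that * by auto
          then show ?thesis using M(1) by linarith
        qed
      qed
      then show "reaches (c u) (c v) (integral {u..v} f + \<delta> * (v - u))"
        using M by simp
    qed
    then show ?case using d(1) by blast
  qed
  then show "reaches (c a) (c b) (integral {a..b} (curve_speed J g c) + \<delta> * (b - a))"
    unfolding P_def using ab eq by simp
qed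

lemma curve_reaches:
  assumes "piecewise_smooth_curve J c" "c ` {0..1} \<subseteq> \<Theta>"
  shows "curve_speed J g c integrable_on {0..1}"
    and "0 < \<delta> \<Longrightarrow> reaches (c 0) (c 1) (integral {0..1} (curve_speed J g c) + \<delta>)"
proof -
  obtain N \<tau> where \<tau>: "\<tau> 0 = 0" "\<tau> N = (1::real)" "\<And>n. n < N \<Longrightarrow> \<tau> n < \<tau> (Suc n)"
    and smooth: "\<And>n j. n < N \<Longrightarrow> j \<in> J \<Longrightarrow> smooth_on_interval (\<tau> n) (\<tau> (Suc n)) (\<lambda>t. c t j)"
    using assms(1) unfolding piecewise_smooth_curve_def by metis
  have mono: "\<tau> i \<le> \<tau> l" if "i \<le> l" "l \<le> N" for i l
    using increasing_steps_imp_le[of N \<tau>, OF \<tau>(3) that] .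
  let ?f = "curve_speed J g c"
  \<comment> \<open>The slack grows in proportion to the elapsed parameter, so at the last
    breakpoint, which is 1, it equals \<open>\<delta>\<close>.\<close>
  have step: "?f integrable_on {0..\<tau> (Suc n)} \<and>
      (\<forall>\<delta>>0. reaches (c 0) (c (\<tau> (Suc n))) (integral {0..\<tau> (Suc n)} ?f + \<delta> * \<tau> (Suc n)))"
    if "n < N" for n
    using that
  proof (induction n)
    case 0
    have "c ` {\<tau> 0..\<tau> (Suc 0)} \<subseteq> \<Theta>"
      using assms(2) mono[of "Suc 0" N] 0 \<tau> by auto
    from smooth_piece_reaches[OF smooth this \<tau>(3)]
    have "?f integrable_on {\<tau> 0..\<tau> (Suc 0)}"
      "\<And>\<delta>. 0 < \<delta> \<Longrightarrow> reaches (c (\<tau> 0)) (c (\<tau> (Suc 0)))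
        (integral {\<tau> 0..\<tau> (Suc 0)} ?f + \<delta> * (\<tau> (Suc 0) - \<tau> 0))"
      using 0 zero_less_one by blast+
    then show ?case using \<tau>(1) by simp
  next
    case (Suc n)
    have "c ` {\<tau> (Suc n)..\<tau> (Suc (Suc n))} \<subseteq> \<Theta>"
      using assms(2) mono[of "Suc (Suc n)" N] mono[of 0 "Suc n"] Suc.prems \<tau> by auto
    from smooth_piece_reaches[OF smooth this \<tau>(3)]
    have piece: "?f integrable_on {\<tau> (Suc n)..\<tau> (Suc (Suc n))}"
      "\<And>\<delta>. 0 < \<delta> \<Longrightarrow> reaches (c (\<tau> (Suc n))) (c (\<tau> (Suc (Suc n))))
        (integral {\<tau> (Suc n)..\<tau> (Suc (Suc n))} ?f + \<delta> * (\<tau> (Suc (Suc n)) - \<tau> (Suc n)))"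
      using Suc.prems zero_less_one by blast+
    have le: "0 \<le> \<tau> (Suc n)" "\<tau> (Suc n) \<le> \<tau> (Suc (Suc n))"
      using mono[of 0 "Suc n"] mono[of "Suc n" "Suc (Suc n)"] Suc.prems \<tau> by auto
    have int: "?f integrable_on {0..\<tau> (Suc (Suc n))}"
      by (rule Henstock_Kurzweil_Integration.integrable_combine[OF le]) (use Suc piece(1) in auto)
    have split: "integral {0..\<tau> (Suc n)} ?f + integral {\<tau> (Suc n)..\<tau> (Suc (Suc n))} ?f
        = integral {0..\<tau> (Suc (Suc n))} ?f"
      using le int by (intro Henstock_Kurzweil_Integration.integral_combine)
    have "reaches (c 0) (c (\<tau> (Suc (Suc n)))) (integral {0..\<tau> (Suc (Suc n))} ?f + \<delta> * \<tau> (Suc (Suc n)))"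
      if "0 < \<delta>" for \<delta>
    proof -
      have "reaches (c 0) (c (\<tau> (Suc n))) (integral {0..\<tau> (Suc n)} ?f + \<delta> * \<tau> (Suc n))"
        using Suc that by simp
      from reaches_trans[OF this piece(2)[OF that]] show ?thesis
        unfolding split[symmetric] by (simp add: algebra_simps)
    qed
    with int show ?case by blast
  qed
  have "N \<noteq> 0" using \<tau> by (metis zero_neq_one)
  then obtain n where "N = Suc n" by (cases N) auto
  then have "?f integrable_on {0..1} \<and> (\<forall>\<delta>>0. reaches (c 0) (c 1) (integral {0..1} ?f + \<delta>))"
    using step[of n] \<tau>(2) by simp
  then show "?f integrable_on {0..1}"
    "0 < \<delta> \<Longrightarrow> reaches (c 0) (c 1) (integral {0..1} ?f + \<delta>)" by auto
qed

section \<open>Joining points of a connected parameter set\<close>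

lemma locally_reaches:
  assumes z: "z \<in> \<Theta>"
  obtains U where "openin (powertop_real J) U" "z \<in> U" "U \<subseteq> \<Theta>"
    "\<And>x y. x \<in> U \<Longrightarrow> y \<in> U \<Longrightarrow> \<exists>T. reaches x y T"
proof -
  obtain V where V: "\<forall>j\<in>J. openin euclideanreal (V j)" "z \<in> PiE J V" "PiE J V \<subseteq> \<Theta>"
    using open_\<Theta>[unfolded openin_product_topology_alt, rule_format, OF z] by blast
  have "\<exists>e>0. ball (z j) e \<subseteq> V j" if "j \<in> J" for j
    using V(1,2) that unfolding open_openin[symmetric] by (meson PiE_mem open_contains_ball)
  then obtain e where e: "\<And>j. j \<in> J \<Longrightarrow> 0 < e j" "\<And>j. j \<in> J \<Longrightarrow> ball (z j) (e j) \<subseteq> V j"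
    by metis
  \<comment> \<open>A box of open intervals inside the basic neighbourhood given by the product
    topology. It is convex, so segments between its points stay in \<open>\<Theta>\<close>.\<close>
  let ?U = "PiE J (\<lambda>j. ball (z j) (e j))"
  have sub: "?U \<subseteq> \<Theta>" using PiE_mono[of J _ V, OF e(2)] V(3) by simp
  show ?thesis
  proof
    show "openin (powertop_real J) ?U"
      using finite_J by (simp add: openin_PiE)
    show "z \<in> ?U" using V(2) e(1) by (auto simp: PiE_iff)
    show "?U \<subseteq> \<Theta>" by (rule sub)
    fix x y assume xy: "x \<in> ?U" "y \<in> ?U"
    \<comment> \<open>The restriction to \<open>J\<close> keeps the segment among the extensional
      functions and makes its end points equal to \<open>x\<close> and \<open>y\<close> as
      functions.\<close>
    let ?c = "\<lambda>t. \<lambda>j\<in>J. x j + t * (y j - x j)"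
    have "?c ` {0..1} \<subseteq> ?U"
    proof (rule image_subsetI)
      fix t :: real assume t: "t \<in> {0..1}"
      have "x j + t * (y j - x j) \<in> ball (z j) (e j)" if "j \<in> J" for j
      proof -
        have "(1 - t) *\<^sub>R x j + t *\<^sub>R y j \<in> ball (z j) (e j)"
          using xy that t by (intro convexD[OF convex_ball]) (auto simp: PiE_iff)
        then show ?thesis by (simp add: algebra_simps)
      qed
      then show "?c t \<in> ?U" by auto
    qed
    then have "?c ` {0..1} \<subseteq> \<Theta>" using sub by blast
    moreover have "smooth_on_interval 0 1 (\<lambda>t. ?c t j)" if "j \<in> J" for j
      using that smooth_on_interval_linear by simp
    ultimately have "\<exists>T. reaches (?c 0) (?c 1) T"
      using smooth_piece_reaches(2)[of 0 1 ?c 1] by auto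
    moreover have "?c 0 = x" "?c 1 = y"
      using xy by (auto simp: PiE_iff extensional_def fun_eq_iff restrict_def)
    ultimately show "\<exists>T. reaches x y T" by simp
  qed
qed

text \<open>The set reached from \<open>x\<close> and its complement in \<open>\<Theta>\<close> are
  both open: near any point \<open>z\<close> travel is possible in both directions, so
  \<open>z\<close> is reached as soon as one of its neighbours is, and conversely. Connectedness
  then leaves no room for the complement.\<close>

lemma all_reached:
  assumes "x \<in> \<Theta>" "y \<in> \<Theta>"
  obtains T where "reaches x y T"
proof -
  let ?A = "{y \<in> \<Theta>. \<exists>T. reaches x y T}"
  let ?B = "{y \<in> \<Theta>. \<not> (\<exists>T. reaches x y T)}"
  have "openin (powertop_real J) ?A"
  proof (subst openin_subopen, safe)
    fix z T assume z: "z \<in> \<Theta>" "reaches x z T"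
    obtain U where "openin (powertop_real J) U" "z \<in> U" "U \<subseteq> \<Theta>"
      "\<And>x y. x \<in> U \<Longrightarrow> y \<in> U \<Longrightarrow> \<exists>T. reaches x y T"
      by (rule locally_reaches[OF z(1)]) blast
    then show "\<exists>U. openin (powertop_real J) U \<and> z \<in> U \<and> U \<subseteq> ?A"
      using reaches_trans[OF z(2)] by (intro exI[of _ U]) blast
  qed
  moreover have "openin (powertop_real J) ?B"
  proof (subst openin_subopen, rule ballI)
    fix z assume "z \<in> ?B"
    then have z: "z \<in> \<Theta>" "\<not> (\<exists>T. reaches x z T)" by auto
    obtain U where "openin (powertop_real J) U" "z \<in> U" "U \<subseteq> \<Theta>"
      "\<And>x y. x \<in> U \<Longrightarrow> y \<in> U \<Longrightarrow> \<exists>T. reaches x y T"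
      by (rule locally_reaches[OF z(1)]) blast
    then show "\<exists>U. openin (powertop_real J) U \<and> z \<in> U \<and> U \<subseteq> ?B"
      using reaches_trans z(2) by (intro exI[of _ U]) blast
  qed
  moreover have "x \<in> ?A" using assms(1) reaches_refl zero_less_one by blast
  moreover have "\<Theta> \<subseteq> ?A \<union> ?B" "?A \<inter> ?B \<inter> \<Theta> = {}" by auto
  ultimately have "?B \<inter> \<Theta> = {}"
    using connected_\<Theta> unfolding connectedin by (metis (no_types, lifting) IntI assms(1) empty_iff)
  then show ?thesis using assms(2) that by blast
qed

end

section \<open>Fisher information of a product model\<close>

text \<open>A positive constant factor of the density becomes an additive constant of its logarithm.
  The convention that the score is zero at bad points forces a second check, that positivity and
  differentiability hold for both densities or for neither.\<close>

lemma score_mult_const: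
  assumes "0 < C" "\<And>t. p (\<theta>(j := t)) x = C * q (\<eta>(l := t)) y" "p \<theta> x = C * q \<eta> y" "\<theta> j = \<eta> l"
  shows "score p j \<theta> x = score q l \<eta> y"
proof (cases "0 < q \<eta> y \<and> (\<lambda>t. q (\<eta>(l := t)) y) differentiable (at (\<eta> l))")
  case True
  have "continuous (at (\<eta> l)) (\<lambda>t. q (\<eta>(l := t)) y)"
    using True by (simp add: differentiable_imp_continuous_within)
  then have "((\<lambda>t. q (\<eta>(l := t)) y) \<longlongrightarrow> q (\<eta>(l := \<eta> l)) y) (nhds (\<eta> l))"
    using tendsto_at_iff_tendsto_nhds[of "\<lambda>t. q (\<eta>(l := t)) y" "\<eta> l"] by (simp add: isCont_def)
  \<comment> \<open>The product rule for \<open>ln\<close> is used at positive arguments, and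
    equality of derivatives needs it on a neighbourhood; continuity extends positivity from the
    point.\<close>
  then have "\<forall>\<^sub>F t in nhds (\<eta> l). 0 < q (\<eta>(l := t)) y"
    by (rule order_tendstoD) (use True in simp)
  then have "\<forall>\<^sub>F t in nhds (\<eta> l). ln (p (\<theta>(j := t)) x) = ln C + ln (q (\<eta>(l := t)) y)"
    by eventually_elim (use assms(1,2) in \<open>simp add: ln_mult\<close>)
  then have "deriv (\<lambda>t. ln (p (\<theta>(j := t)) x)) (\<eta> l) = deriv (\<lambda>t. ln C + ln (q (\<eta>(l := t)) y)) (\<eta> l)"
    by (rule deriv_cong_ev) simp
  also have "\<dots> = deriv (\<lambda>t. ln (q (\<eta>(l := t)) y)) (\<eta> l)"
  proof (rule DERIV_imp_deriv)
    obtain D where D: "((\<lambda>t. q (\<eta>(l := t)) y) has_real_derivative D) (at (\<eta> l))"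
      using True real_differentiable_def by blast
    have "((\<lambda>t. ln (q (\<eta>(l := t)) y)) has_real_derivative D / q (\<eta>(l := \<eta> l)) y) (at (\<eta> l))"
      using True by (auto intro!: derivative_eq_intros D)
    then have "((\<lambda>t. ln (q (\<eta>(l := t)) y)) has_real_derivative
        deriv (\<lambda>t. ln (q (\<eta>(l := t)) y)) (\<eta> l)) (at (\<eta> l))"
      by (metis DERIV_imp_deriv)
    from DERIV_add[OF DERIV_const[of "ln C"] this]
    show "((\<lambda>t. ln C + ln (q (\<eta>(l := t)) y)) has_real_derivative
        deriv (\<lambda>t. ln (q (\<eta>(l := t)) y)) (\<eta> l)) (at (\<eta> l))"
      by simp
  qed
  finally show ?thesis
    using True assms by (simp add: score_def)
next
  case False
  have "(\<lambda>t. q (\<eta>(l := t)) y) differentiable (at (\<eta> l))"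
    if "(\<lambda>t. C * q (\<eta>(l := t)) y) differentiable (at (\<eta> l))"
  proof -
    have "(\<lambda>t. inverse C * (C * q (\<eta>(l := t)) y)) differentiable (at (\<eta> l))"
      by (rule differentiable_mult[OF differentiable_const that])
    moreover have "(\<lambda>t. inverse C * (C * q (\<eta>(l := t)) y)) = (\<lambda>t. q (\<eta>(l := t)) y)"
      using assms(1) by (simp add: mult.assoc[symmetric])
    ultimately show ?thesis by (simp only:)
  qed
  moreover have "0 < q \<eta> y" if "0 < C * q \<eta> y"
    using that assms(1) by (simp add: zero_less_mult_iff)
  ultimately have "\<not> (0 < p \<theta> x \<and> (\<lambda>t. p (\<theta>(j := t)) x) differentiable (at (\<theta> j)))"
    using False unfolding assms(2-4) by blast
  then show ?thesis using False by (auto simp: score_def)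
qed

lemma block_in_params: "\<theta> \<in> product_params k m \<Theta> \<Longrightarrow> i < k \<Longrightarrow> block m \<theta> i \<in> \<Theta> i"
  by (simp add: product_params_def)

lemma block_update:
  assumes "j < m i"
  shows "block m (\<theta>((i, j) := t)) i' = (if i' = i then (block m \<theta> i)(j := t) else block m \<theta> i')"
  using assms by (auto simp: block_def fun_eq_iff restrict_def)

locale product_model =
  fixes k :: nat and m :: "nat \<Rightarrow> nat" and \<Theta> :: "nat \<Rightarrow> (nat \<Rightarrow> real) set"
    and \<mu> :: "nat \<Rightarrow> 'x measure" and p :: "nat \<Rightarrow> (nat \<Rightarrow> real) \<Rightarrow> 'x \<Rightarrow> real"
  assumes factor: "\<And>i. i < k \<Longrightarrow> regular_statistical_model {..<m i} (\<Theta> i) (\<mu> i) (p i)"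
begin

lemma factor_density_nonneg:
  "\<theta> \<in> product_params k m \<Theta> \<Longrightarrow> i < k \<Longrightarrow> x \<in> space (\<mu> i) \<Longrightarrow> 0 \<le> p i (block m \<theta> i) x"
  using regular_statistical_model.density_nonneg[OF factor] block_in_params by metis

text \<open>The remaining factors do not depend on the coordinate \<open>(i, j)\<close>, so they act
  as a constant, positive when the whole product is. Where the product vanishes its score is zero by
  convention, although the score of the single factor may be nonzero; hence the conditional.\<close>

lemma score_product_density:
  assumes \<theta>: "\<theta> \<in> product_params k m \<Theta>" and i: "i < k" "j < m i"
    and x: "x \<in> space (\<Pi>\<^sub>M i\<in>{..<k}. \<mu> i)"
  shows "score (product_density k m p) (i, j) \<theta> x =
    (if 0 < product_density k m p \<theta> x then score (p i) j (block m \<theta> i) (x i) else 0)"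
proof (cases "0 < product_density k m p \<theta> x")
  case True
  let ?C = "\<Prod>l\<in>{..<k} - {i}. p l (block m \<theta> l) (x l)"
  have split: "product_density k m p \<eta> x = p i (block m \<eta> i) (x i) * (\<Prod>l\<in>{..<k} - {i}. p l (block m \<eta> l) (x l))"
    for \<eta> unfolding product_density_def using i by (intro prod.remove) auto
  have "0 \<le> p l (block m \<theta> l) (x l)" if "l < k" for l
    using factor_density_nonneg[OF \<theta> that] x that by (auto simp: space_PiM PiE_iff)
  then have "0 \<le> ?C" by (intro prod_nonneg) auto
  moreover have "?C \<noteq> 0" using True split[of \<theta>] by (metis mult_zero_right less_irrefl)
  ultimately have "0 < ?C" by linarith
  then have "score (product_density k m p) (i, j) \<theta> x = score (p i) j (block m \<theta> i) (x i)"
  proof (rule score_mult_const)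
    show "product_density k m p \<theta> x = ?C * p i (block m \<theta> i) (x i)"
      by (simp add: split)
    show "\<theta> (i, j) = block m \<theta> i j" using i by (simp add: block_def)
    show "product_density k m p (\<theta>((i, j) := t)) x = ?C * p i ((block m \<theta> i)(j := t)) (x i)" for t
      unfolding split using i by (simp add: block_update mult.commute)
  qed
  then show ?thesis using True by simp
qed (simp add: score_def)

text \<open>Fubini splits the expectation into one integral per factor. For \<open>i = l\<close>
  both scores fall into the same factor and the other densities integrate to 1; for
  \<open>i \<noteq> l\<close> one of the integrals is the mean of a score, which is 0.\<close>

lemma fisher_information_product:
  assumes \<theta>: "\<theta> \<in> product_params k m \<Theta>" and i: "i < k" "j < m i" and l: "l < k" "n < m l"
  shows "fisher_information (\<Pi>\<^sub>M i\<in>{..<k}. \<mu> i) (product_density k m p) \<theta> (i, j) (l, n) =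
    (if i = l then fisher_information (\<mu> i) (p i) (block m \<theta> i) j n else 0)"
proof -
  \<comment> \<open>\<open>product_sigma_finite\<close> asks for sigma-finiteness at every natural
    number, so the family is padded with a trivial measure beyond \<open>k\<close>.\<close>
  define \<nu> where "\<nu> i = (if i < k then \<mu> i else count_space {})" for i
  have "sigma_finite_measure (\<nu> i)" for i
    using factor[of i] by (simp add: \<nu>_def regular_statistical_model_def
        sigma_finite_measure_count_space_finite)
  then interpret product_sigma_finite \<nu>
    by (rule product_sigma_finite.intro)
  let ?M = "\<Pi>\<^sub>M i\<in>{..<k}. \<mu> i" and ?P = "product_density k m p"
  have M: "?M = PiM {..<k} \<nu>" by (intro PiM_cong) (auto simp: \<nu>_def)
  let ?s = "\<lambda>i j. score (p i) j (block m \<theta> i)"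
  let ?q = "\<lambda>i. p i (block m \<theta> i)"
  have q_meas: "?q a \<in> borel_measurable (\<mu> a)" if "a < k" for a
    using regular_statistical_model.density_measurable[OF factor] block_in_params[OF \<theta>] that by blast
  have s_meas: "?s a b \<in> borel_measurable (\<mu> a)" if "a < k" "b < m a" for a b
  proof -
    have "integrable (model_dist (\<mu> a) (p a) (block m \<theta> a)) (?s a b)"
      using regular_statistical_model.score_integrable[OF factor] block_in_params[OF \<theta>] that by blast
    then show ?thesis by (auto simp: model_dist_def dest!: borel_measurable_integrable)
  qed
  have q_nonneg: "AE x in \<mu> a. 0 \<le> ?q a x" if "a < k" for a
    using factor_density_nonneg[OF \<theta> that] by auto
  have P_nonneg: "0 \<le> ?P \<theta> x" if "x \<in> space ?M" for x
    unfolding product_density_def using factor_density_nonneg[OF \<theta>] that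
    by (intro prod_nonneg) (auto simp: space_PiM PiE_iff)
  have int_dist: "integrable (model_dist (\<mu> a) (p a) (block m \<theta> a)) f \<longleftrightarrow> integrable (\<mu> a) (\<lambda>x. ?q a x * f x)"
    "integral\<^sup>L (model_dist (\<mu> a) (p a) (block m \<theta> a)) f = (\<integral>x. ?q a x * f x \<partial>\<mu> a)"
    if "a < k" "f \<in> borel_measurable (\<mu> a)" for a and f :: "'x \<Rightarrow> real"
    using integrable_density[OF that(2) q_meas q_nonneg] integral_density[OF that(2) q_meas q_nonneg] that(1)
    unfolding model_dist_def by auto
  have dist_prob: "prob_space (model_dist (\<mu> a) (p a) (block m \<theta> a))" if "a < k" for a
    using regular_statistical_model.density_prob[OF factor] block_in_params[OF \<theta>] that by blast
  have q: "integrable (\<mu> a) (?q a)" "(\<integral>x. ?q a x \<partial>\<mu> a) = 1" if "a < k" for a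
  proof -
    interpret prob_space "model_dist (\<mu> a) (p a) (block m \<theta> a)" by (rule dist_prob[OF that])
    show "integrable (\<mu> a) (?q a)" "(\<integral>x. ?q a x \<partial>\<mu> a) = 1"
      using int_dist[OF that, of "\<lambda>_. 1"] prob_space by auto
  qed
  have qs: "integrable (\<mu> a) (\<lambda>x. ?q a x * ?s a b x)" "(\<integral>x. ?q a x * ?s a b x \<partial>\<mu> a) = 0"
    if "a < k" "b < m a" for a b
    using int_dist[OF that(1) s_meas[OF that]] that block_in_params[OF \<theta> that(1)]
      regular_statistical_model.score_integrable[OF factor[OF that(1)], of "block m \<theta> a" b]
      regular_statistical_model.score_mean_zero[OF factor[OF that(1)], of "block m \<theta> a" b]
    by auto
  have qss: "integrable (\<mu> a) (\<lambda>x. ?q a x * (?s a b x * ?s a b' x))"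
    "(\<integral>x. ?q a x * (?s a b x * ?s a b' x) \<partial>\<mu> a) = fisher_information (\<mu> a) (p a) (block m \<theta> a) b b'"
    if "a < k" "b < m a" "b' < m a" for a b b'
  proof -
    have "(\<lambda>x. ?s a b x * ?s a b' x) \<in> borel_measurable (\<mu> a)"
      using s_meas that by (intro borel_measurable_times) auto
    from int_dist[OF that(1) this]
    show "integrable (\<mu> a) (\<lambda>x. ?q a x * (?s a b x * ?s a b' x))"
      "(\<integral>x. ?q a x * (?s a b x * ?s a b' x) \<partial>\<mu> a) = fisher_information (\<mu> a) (p a) (block m \<theta> a) b b'"
      using that block_in_params[OF \<theta> that(1)]
        regular_statistical_model.fisher_well_defined[OF factor[OF that(1)], of "block m \<theta> a" b b']
      by (auto simp: fisher_information_def)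
  qed
  have comp: "(\<lambda>x. f (x a)) \<in> borel_measurable ?M"
    if "a < k" "f \<in> borel_measurable (\<mu> a)" for a and f :: "'x \<Rightarrow> real"
    by (rule measurable_compose[OF _ that(2)]) (use that(1) in simp)
  have P_meas: "?P \<theta> \<in> borel_measurable ?M"
    unfolding product_density_def by (intro borel_measurable_prod comp q_meas) auto
  let ?S = "\<lambda>a b x. if 0 < ?P \<theta> x then ?s a b (x a) else 0"
  have S_meas: "?S a b \<in> borel_measurable ?M" if "a < k" "b < m a" for a b
    using comp[OF that(1) s_meas[OF that]] P_meas by (intro measurable_If) auto
  \<comment> \<open>The share of coordinate \<open>a\<close> in the integrand, written so that the
    diagonal and off-diagonal cases are covered together.\<close>
  define F where "F a y = ?q a y * ((if a = i then ?s i j y else 1) * (if a = l then ?s l n y else 1))" for a y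
  have F_int: "integrable (\<nu> a) (F a)" if "a < k" for a
    using that q[of a] qs(1)[OF i] qs(1)[OF l] qss(1)[OF i, of n] l unfolding F_def \<nu>_def
    by (cases "a = i"; cases "a = l") auto
  have "fisher_information ?M ?P \<theta> (i, j) (l, n) =
      (\<integral>x. ?S i j x * ?S l n x \<partial>density ?M (\<lambda>x. ennreal (?P \<theta> x)))"
    unfolding fisher_information_def model_dist_def
    by (intro Bochner_Integration.integral_cong refl)
      (simp add: score_product_density[OF \<theta> i] score_product_density[OF \<theta> l])
  also have "\<dots> = (\<integral>x. ?P \<theta> x *\<^sub>R (?S i j x * ?S l n x) \<partial>?M)"
    using P_nonneg by (intro integral_density borel_measurable_times S_meas i l P_meas) auto
  also have "\<dots> = (\<integral>x. (\<Prod>a<k. F a (x a)) \<partial>?M)"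
  proof (intro Bochner_Integration.integral_cong refl)
    fix x assume x: "x \<in> space ?M"
    have "(\<Prod>a<k. F a (x a)) = ?P \<theta> x * (?s i j (x i) * ?s l n (x l))"
      unfolding F_def product_density_def prod.distrib using i l
      by (simp add: prod.delta)
    \<comment> \<open>Where the product density is zero both sides vanish, so the conditional in
      \<open>?S\<close> has no effect on the integral.\<close>
    then show "?P \<theta> x *\<^sub>R (?S i j x * ?S l n x) = (\<Prod>a<k. F a (x a))"
      using P_nonneg[OF x] by auto
  qed
  also have "\<dots> = (\<Prod>a<k. integral\<^sup>L (\<nu> a) (F a))"
    unfolding M using F_int by (intro product_integral_prod) auto
  also have "\<dots> = (if i = l then fisher_information (\<mu> i) (p i) (block m \<theta> i) j n else 0)"
  proof (cases "i = l")
    case True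
    have "integral\<^sup>L (\<nu> a) (F a) = (if a = i then fisher_information (\<mu> i) (p i) (block m \<theta> i) j n else 1)"
      if "a < k" for a
      using that q(2)[of a] qss(2)[OF i, of n] l True unfolding F_def \<nu>_def by auto
    then have "(\<Prod>a<k. integral\<^sup>L (\<nu> a) (F a))
       = (\<Prod>a<k. if a = i then fisher_information (\<mu> i) (p i) (block m \<theta> i) j n else 1)"
      by (intro prod.cong) auto
    then show ?thesis using True i by (simp add: prod.delta)
  next
    case False
    have "integral\<^sup>L (\<nu> i) (F i) = 0"
      using False qs(2)[OF i] i unfolding F_def \<nu>_def by simp
    then show ?thesis using False i by (auto intro!: prod_zero)
  qed
  finally show ?thesis .
qed

end

section \<open>Distances in a product\<close>

text \<open>Minkowski's inequality by duality: the vector of integrals \<open>len\<close> serves as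
  the test vector, Cauchy-Schwarz is applied at each time, and one factor
  \<open>L2_set len I\<close> is cancelled at the end. Integrability of the norm comes from
  domination by the sum of the entries.\<close>

lemma L2_set_integral_le:
  fixes f :: "'i \<Rightarrow> real \<Rightarrow> real"
  assumes I: "finite I" and f: "\<And>i. i \<in> I \<Longrightarrow> f i integrable_on {a..b}"
    and nonneg: "\<And>i t. i \<in> I \<Longrightarrow> t \<in> {a..b} \<Longrightarrow> 0 \<le> f i t"
  shows "(\<lambda>t. L2_set (\<lambda>i. f i t) I) integrable_on {a..b}"
    and "L2_set (\<lambda>i. integral {a..b} (f i)) I \<le> integral {a..b} (\<lambda>t. L2_set (\<lambda>i. f i t) I)"
proof -
  show int: "(\<lambda>t. L2_set (\<lambda>i. f i t) I) integrable_on {a..b}"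
  proof (rule measurable_bounded_by_integrable_imp_integrable_real)
    have [measurable]: "f i \<in> borel_measurable (lebesgue_on {a..b})" if "i \<in> I" for i
      using f[OF that] by (rule integrable_imp_measurable)
    show "(\<lambda>t. L2_set (\<lambda>i. f i t) I) \<in> borel_measurable (lebesgue_on {a..b})"
      unfolding L2_set_def by measurable
    show "(\<lambda>t. \<Sum>i\<in>I. f i t) integrable_on {a..b}"
      using I f by (intro integrable_sum) auto
    show "\<bar>L2_set (\<lambda>i. f i t) I\<bar> \<le> (\<Sum>i\<in>I. f i t)" if "t \<in> {a..b}" for t
      using L2_set_le_sum[of I "\<lambda>i. f i t"] nonneg that by simp
  qed simp
  define len where "len i = integral {a..b} (f i)" for i
  let ?L = "integral {a..b} (\<lambda>t. L2_set (\<lambda>i. f i t) I)"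
  have len_nonneg: "0 \<le> len i" if "i \<in> I" for i
    unfolding len_def using nonneg f that by (intro integral_nonneg) auto
  have "(L2_set len I)\<^sup>2 = (\<Sum>i\<in>I. len i * integral {a..b} (f i))"
    by (simp add: L2_set_def sum_nonneg len_def power2_eq_square)
  also have "\<dots> = integral {a..b} (\<lambda>t. \<Sum>i\<in>I. len i * f i t)"
    using I f by (subst integral_sum) (auto intro: integrable_on_mult_right)
  also have "\<dots> \<le> integral {a..b} (\<lambda>t. L2_set len I * L2_set (\<lambda>i. f i t) I)"
  proof (rule integral_le)
    fix t assume t: "t \<in> {a..b}"
    have "(\<Sum>i\<in>I. len i * f i t) = (\<Sum>i\<in>I. \<bar>len i\<bar> * \<bar>f i t\<bar>)"
      using len_nonneg nonneg t by (intro sum.cong) auto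
    also have "\<dots> \<le> L2_set len I * L2_set (\<lambda>i. f i t) I"
      by (rule L2_set_mult_ineq)
    finally show "(\<Sum>i\<in>I. len i * f i t) \<le> L2_set len I * L2_set (\<lambda>i. f i t) I" .
  qed (use I f int in \<open>auto intro!: integrable_sum integrable_on_mult_right\<close>)
  also have "\<dots> = L2_set len I * ?L" by simp
  finally have "L2_set len I * L2_set len I \<le> L2_set len I * ?L"
    by (simp add: power2_eq_square)
  moreover have "0 \<le> ?L" using int by (intro integral_nonneg) auto
  ultimately show "L2_set (\<lambda>i. integral {a..b} (f i)) I \<le> ?L"
    unfolding len_def[symmetric] by (cases "L2_set len I = 0") (auto simp: mult_le_cancel_left L2_set_nonneg order_less_le)
qed

section \<open>The infimum of path lengths\<close>

context param_metric
begin

definition path_lengths :: "('j \<Rightarrow> real) \<Rightarrow> ('j \<Rightarrow> real) \<Rightarrow> real set" where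
  "path_lengths x y = {integral {0..1} (curve_speed J g c) | c.
     piecewise_smooth_curve J c \<and> c ` {0..1} \<subseteq> \<Theta> \<and> c 0 = x \<and> c 1 = y}"

lemma path_lengths_nonneg: "r \<in> path_lengths x y \<Longrightarrow> 0 \<le> r"
  unfolding path_lengths_def using curve_reaches(1) speed_nonneg
  by (auto intro!: integral_nonneg simp: image_subset_iff)

lemma path_lengths_nonempty:
  assumes "x \<in> \<Theta>" "y \<in> \<Theta>"
  shows "path_lengths x y \<noteq> {}"
proof -
  obtain T where "reaches x y T" using all_reached[OF assms] .
  then obtain c S where "piecewise_smooth_curve J c" "c ` {0..1} \<subseteq> \<Theta>" "c 0 = x" "c 1 = y"
    by (rule reaches_imp_curve)
  then show ?thesis unfolding path_lengths_def by blast
qed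

lemma Inf_path_lengths_nonneg:
  assumes "x \<in> \<Theta>" "y \<in> \<Theta>"
  shows "0 \<le> Inf (path_lengths x y)"
  using path_lengths_nonempty[OF assms] path_lengths_nonneg by (rule cInf_greatest)

lemma Inf_path_lengths_le: "r \<in> path_lengths x y \<Longrightarrow> Inf (path_lengths x y) \<le> r"
  by (intro cInf_lower bdd_belowI[of _ 0] path_lengths_nonneg)

lemma reaches_Inf_path_lengths:
  assumes "x \<in> \<Theta>" "y \<in> \<Theta>" "0 < \<delta>"
  shows "reaches x y (Inf (path_lengths x y) + \<delta>)"
proof -
  have "Inf (path_lengths x y) < Inf (path_lengths x y) + \<delta>" using assms by simp
  then obtain r where r: "r \<in> path_lengths x y" "r < Inf (path_lengths x y) + \<delta>"
    using cInf_lessD[OF path_lengths_nonempty[OF assms(1,2)]] by blast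
  then obtain c where c: "piecewise_smooth_curve J c" "c ` {0..1} \<subseteq> \<Theta>" "c 0 = x" "c 1 = y"
      and "r = integral {0..1} (curve_speed J g c)"
    unfolding path_lengths_def by blast
  \<comment> \<open>The chosen length \<open>r\<close> falls short of the target by a positive
    amount, which is exactly the slack given to \<open>curve_reaches\<close>.\<close>
  then show ?thesis
    using curve_reaches(2)[OF c(1,2), of "Inf (path_lengths x y) + \<delta> - r"] r(2) by simp
qed

end

lemma (in regular_statistical_model) fisher_param_metric:
  "param_metric J \<Theta> (fisher_information M p)"
proof
  show "finite J" by (rule finite_params)
  show "openin (powertop_real J) \<Theta>" by (rule open_params)
  show "connectedin (powertop_real J) \<Theta>" by (rule connected_params)
  show "0 \<le> quadratic_form J (fisher_information M p \<theta>) v" if "\<theta> \<in> \<Theta>" for \<theta> v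
  proof (cases "\<exists>j\<in>J. v j \<noteq> 0")
    case True
    then show ?thesis using fisher_pos_def[OF that] by (simp add: quadratic_form_def less_imp_le)
  next
    case False
    then show ?thesis by (simp add: quadratic_form_def)
  qed
  show "continuous_map (subtopology (powertop_real J) \<Theta>) euclideanreal
      (\<lambda>\<theta>. fisher_information M p \<theta> j l)" if jl: "j \<in> J" "l \<in> J" for j l
  proof -
    obtain D where D: "\<forall>\<theta>\<in>\<Theta>. D [] \<theta> = fisher_information M p \<theta> j l"
      "\<forall>js\<in>lists J. continuous_map (subtopology (powertop_real J) \<Theta>) euclideanreal (D js)"
      using fisher_smooth[OF jl] unfolding smooth_on_params_def by blast
    have "continuous_map (subtopology (powertop_real J) \<Theta>) euclideanreal (D [])"
      using D(2) by simp
    then show ?thesis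
      by (rule continuous_map_eq) (use D(1) in simp)
  qed
qed

lemma fisher_rao_dist_eq:
  "fisher_rao_dist J \<Theta> M p x y = Inf {integral {0..1} (curve_speed J (fisher_information M p) c) | c.
     piecewise_smooth_curve J c \<and> c ` {0..1} \<subseteq> \<Theta> \<and> c 0 = x \<and> c 1 = y}"
  unfolding fisher_rao_dist_def fisher_length_def curve_speed_def quadratic_form_def ..

lemma block_apply: "j < m i \<Longrightarrow> block m \<theta> i j = \<theta> (i, j)"
  by (simp add: block_def)

section \<open>Product curves and their blocks\<close>

lemma piecewise_smooth_curve_block:
  assumes "piecewise_smooth_curve (product_index k m) c" "i < k"
  shows "piecewise_smooth_curve {..<m i} (\<lambda>t. block m (c t) i)"
proof -
  have "(i, j) \<in> product_index k m" if "j < m i" for j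
    using that assms(2) by (simp add: product_index_def)
  moreover obtain N \<tau> where "\<tau> 0 = 0" "\<tau> N = 1" "\<forall>n<N. \<tau> n < \<tau> (Suc n) \<and>
      (\<forall>j\<in>product_index k m. smooth_on_interval (\<tau> n) (\<tau> (Suc n)) (\<lambda>t. c t j))"
    using assms(1) unfolding piecewise_smooth_curve_def by blast
  ultimately show ?thesis
    unfolding piecewise_smooth_curve_def
    by (intro exI[of _ N] exI[of _ \<tau>]) (simp add: block_apply)
qed

text \<open>The factors have unrelated breakpoints; the union of their finite exceptional sets
  serves all coordinates at once.\<close>

lemma piecewise_smooth_curve_product:
  assumes "\<And>i. i < k \<Longrightarrow> piecewise_smooth_curve {..<m i} (C i)"
  shows "piecewise_smooth_curve (product_index k m) (\<lambda>t. \<lambda>(i, j)\<in>product_index k m. C i t j)"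
    (is "piecewise_smooth_curve _ ?c")
proof -
  have "\<exists>S. finite S \<and> (\<forall>u v. 0 \<le> u \<longrightarrow> u < v \<longrightarrow> v \<le> 1 \<longrightarrow> {u<..<v} \<inter> S = {} \<longrightarrow>
        (\<forall>j<m i. smooth_on_interval u v (\<lambda>t. C i t j)))" if "i < k" for i
    using piecewise_smooth_curve_imp_on[OF assms[OF that]] unfolding piecewise_smooth_on_def
    by (simp add: Ball_def)
  then obtain S where S: "\<And>i. i < k \<Longrightarrow> finite (S i)"
    "\<And>i u v j. i < k \<Longrightarrow> 0 \<le> u \<Longrightarrow> u < v \<Longrightarrow> v \<le> 1 \<Longrightarrow> {u<..<v} \<inter> S i = {} \<Longrightarrow> j < m i \<Longrightarrow>
       smooth_on_interval u v (\<lambda>t. C i t j)"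
    by metis
  have smooth: "smooth_on_interval u v (\<lambda>t. ?c t a)"
    if uv: "0 \<le> u" "u < v" "v \<le> 1" "{u<..<v} \<inter> (\<Union>i<k. S i) = {}" and a: "a \<in> product_index k m"
    for u v a
  proof -
    obtain i j where ij: "a = (i, j)" "i < k" "j < m i"
      using a by (auto simp: product_index_def)
    have "{u<..<v} \<inter> S i = {}" using uv(4) ij(2) by blast
    then have "smooth_on_interval u v (\<lambda>t. C i t j)" using S(2) uv ij by blast
    then show ?thesis using a ij by simp
  qed
  have fin: "finite (\<Union>i<k. S i)" using S(1) by simp
  have "piecewise_smooth_on 0 1 (product_index k m) ?c"
    unfolding piecewise_smooth_on_def
    by (intro exI[of _ "\<Union>i<k. S i"] conjI allI impI ballI fin) (rule smooth)
  then show ?thesis by (rule piecewise_smooth_on_imp_curve)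
qed

lemma block_product:
  assumes "i < k" "x \<in> extensional {..<m i}" "\<And>j. j < m i \<Longrightarrow> \<theta> (i, j) = x j"
  shows "block m \<theta> i = x"
  using assms by (auto simp: block_def fun_eq_iff extensional_def)

context product_model
begin

abbreviation factor_metric :: "nat \<Rightarrow> (nat \<Rightarrow> real) \<Rightarrow> nat \<Rightarrow> nat \<Rightarrow> real" where
  "factor_metric i \<equiv> fisher_information (\<mu> i) (p i)"

abbreviation product_metric :: "(nat \<times> nat \<Rightarrow> real) \<Rightarrow> nat \<times> nat \<Rightarrow> nat \<times> nat \<Rightarrow> real" where
  "product_metric \<equiv> fisher_information (\<Pi>\<^sub>M i\<in>{..<k}. \<mu> i) (product_density k m p)"

lemma factor_param_metric: "i < k \<Longrightarrow> param_metric {..<m i} (\<Theta> i) (factor_metric i)"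
  using regular_statistical_model.fisher_param_metric factor by blast

lemma quadratic_form_product:
  assumes "\<theta> \<in> product_params k m \<Theta>"
  shows "quadratic_form (product_index k m) (product_metric \<theta>) v =
    (\<Sum>i<k. quadratic_form {..<m i} (factor_metric i (block m \<theta> i)) (\<lambda>j. v (i, j)))"
proof -
  have "(\<Sum>a\<in>product_index k m. h a) = (\<Sum>i<k. \<Sum>j<m i. h (i, j))" for h :: "nat \<times> nat \<Rightarrow> real"
    using sum.Sigma[of "{..<k}" "\<lambda>i. {..<m i}" "\<lambda>i j. h (i, j)"] by (simp add: product_index_def)
  then have "quadratic_form (product_index k m) (product_metric \<theta>) v =
    (\<Sum>i<k. \<Sum>j<m i. \<Sum>l<k. \<Sum>n<m l. v (i, j) * product_metric \<theta> (i, j) (l, n) * v (l, n))"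
    unfolding quadratic_form_def by simp
  also have "\<dots> = (\<Sum>i<k. \<Sum>j<m i. \<Sum>l<k. if l = i then
      (\<Sum>n<m i. v (i, j) * factor_metric i (block m \<theta> i) j n * v (i, n)) else 0)"
    by (intro sum.cong refl) (auto simp: fisher_information_product[OF assms])
  also have "\<dots> = (\<Sum>i<k. quadratic_form {..<m i} (factor_metric i (block m \<theta> i)) (\<lambda>j. v (i, j)))"
    unfolding quadratic_form_def by (rule sum.cong[OF refl], rule sum.cong[OF refl]) simp
  finally show ?thesis .
qed

lemma curve_speed_product:
  assumes "c t \<in> product_params k m \<Theta>"
  shows "curve_speed (product_index k m) product_metric c t =
    L2_set (\<lambda>i. curve_speed {..<m i} (factor_metric i) (\<lambda>s. block m (c s) i) t) {..<k}"
proof -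
  have "quadratic_form {..<m i} (factor_metric i (block m (c t) i)) (\<lambda>j. deriv (\<lambda>s. c s (i, j)) t) =
    (curve_speed {..<m i} (factor_metric i) (\<lambda>s. block m (c s) i) t)\<^sup>2" if i: "i < k" for i
  proof -
    interpret param_metric "{..<m i}" "\<Theta> i" "factor_metric i" by (rule factor_param_metric[OF i])
    have "quadratic_form {..<m i} (factor_metric i (block m (c t) i)) (\<lambda>j. deriv (\<lambda>s. c s (i, j)) t)
      = quadratic_form {..<m i} (factor_metric i (block m (c t) i)) (\<lambda>j. deriv (\<lambda>s. block m (c s) i j) t)"
      by (intro quadratic_form_cong) (simp add: block_apply)
    \<comment> \<open>Nonnegativity of the form of each block is what makes the squared speed return
      the form.\<close>
    then show ?thesis
      using nonneg[OF block_in_params[OF assms i]] by (simp add: curve_speed_def)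
  qed
  then show ?thesis
    by (simp add: curve_speed_def[of "product_index k m"] quadratic_form_product[OF assms] L2_set_def)
qed

lemma factor_curve:
  assumes "piecewise_smooth_curve (product_index k m) c" "c ` {0..1} \<subseteq> product_params k m \<Theta>" "i < k"
  shows "piecewise_smooth_curve {..<m i} (\<lambda>t. block m (c t) i)" "(\<lambda>t. block m (c t) i) ` {0..1} \<subseteq> \<Theta> i"
    "curve_speed {..<m i} (factor_metric i) (\<lambda>t. block m (c t) i) integrable_on {0..1}"
    "\<And>t. t \<in> {0..1} \<Longrightarrow> 0 \<le> curve_speed {..<m i} (factor_metric i) (\<lambda>t. block m (c t) i) t"
proof -
  interpret param_metric "{..<m i}" "\<Theta> i" "factor_metric i" by (rule factor_param_metric[OF assms(3)])
  show c: "piecewise_smooth_curve {..<m i} (\<lambda>t. block m (c t) i)" "(\<lambda>t. block m (c t) i) ` {0..1} \<subseteq> \<Theta> i"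
    using piecewise_smooth_curve_block assms block_in_params by blast+
  show "curve_speed {..<m i} (factor_metric i) (\<lambda>t. block m (c t) i) integrable_on {0..1}"
    by (rule curve_reaches(1)[OF c])
  show "0 \<le> curve_speed {..<m i} (factor_metric i) (\<lambda>t. block m (c t) i) t" if "t \<in> {0..1}" for t
    using c(2) that by (intro speed_nonneg) blast
qed

abbreviation product_speed :: "(real \<Rightarrow> nat \<times> nat \<Rightarrow> real) \<Rightarrow> real \<Rightarrow> real" where
  "product_speed \<equiv> curve_speed (product_index k m) product_metric"

abbreviation factor_dist :: "nat \<Rightarrow> (nat \<Rightarrow> real) \<Rightarrow> (nat \<Rightarrow> real) \<Rightarrow> real" where
  "factor_dist i \<equiv> fisher_rao_dist {..<m i} (\<Theta> i) (\<mu> i) (p i)"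

lemma product_length:
  assumes "piecewise_smooth_curve (product_index k m) c" "c ` {0..1} \<subseteq> product_params k m \<Theta>"
  shows "product_speed c integrable_on {0..1}"
    and "L2_set (\<lambda>i. integral {0..1} (curve_speed {..<m i} (factor_metric i) (\<lambda>t. block m (c t) i))) {..<k}
      \<le> integral {0..1} (product_speed c)"
proof -
  let ?f = "\<lambda>i. curve_speed {..<m i} (factor_metric i) (\<lambda>t. block m (c t) i)"
  have eq: "L2_set (\<lambda>i. ?f i t) {..<k} = product_speed c t" if "t \<in> {0..1}" for t
    by (rule curve_speed_product[symmetric]) (use assms(2) that in blast)
  have int: "(\<lambda>t. L2_set (\<lambda>i. ?f i t) {..<k}) integrable_on {0..1}"
    and le: "L2_set (\<lambda>i. integral {0..1} (?f i)) {..<k} \<le> integral {0..1} (\<lambda>t. L2_set (\<lambda>i. ?f i t) {..<k})"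
    by (rule L2_set_integral_le; use factor_curve[OF assms] in simp)+
  show "product_speed c integrable_on {0..1}"
    using int by (rule integrable_eq) (simp add: eq)
  have "integral {0..1} (\<lambda>t. L2_set (\<lambda>i. ?f i t) {..<k}) = integral {0..1} (product_speed c)"
    by (rule Henstock_Kurzweil_Integration.integral_cong) (rule eq)
  then show "L2_set (\<lambda>i. integral {0..1} (?f i)) {..<k} \<le> integral {0..1} (product_speed c)"
    using le by simp
qed

lemma factor_dist_nonneg:
  assumes "i < k" "x \<in> \<Theta> i" "y \<in> \<Theta> i"
  shows "0 \<le> factor_dist i x y"
proof -
  interpret param_metric "{..<m i}" "\<Theta> i" "factor_metric i" by (rule factor_param_metric[OF assms(1)])
  show ?thesis
    using Inf_path_lengths_nonneg[OF assms(2,3)] by (simp add: fisher_rao_dist_eq path_lengths_def)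
qed

text \<open>Each block of \<open>c\<close> competes in the infimum of its factor. Passing to the
  Euclidean norm preserves the inequalities because distances are nonnegative, and Minkowski's
  inequality finishes the estimate.\<close>

lemma product_length_ge:
  assumes \<theta>: "\<theta>\<^sub>0 \<in> product_params k m \<Theta>" "\<theta>\<^sub>1 \<in> product_params k m \<Theta>"
    and c: "piecewise_smooth_curve (product_index k m) c" "c ` {0..1} \<subseteq> product_params k m \<Theta>"
      "c 0 = \<theta>\<^sub>0" "c 1 = \<theta>\<^sub>1"
  shows "L2_set (\<lambda>i. factor_dist i (block m \<theta>\<^sub>0 i) (block m \<theta>\<^sub>1 i)) {..<k} \<le> integral {0..1} (product_speed c)"
proof -
  have "factor_dist i (block m \<theta>\<^sub>0 i) (block m \<theta>\<^sub>1 i) \<le>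
      integral {0..1} (curve_speed {..<m i} (factor_metric i) (\<lambda>t. block m (c t) i))" if i: "i < k" for i
  proof -
    interpret param_metric "{..<m i}" "\<Theta> i" "factor_metric i" by (rule factor_param_metric[OF i])
    have "integral {0..1} (curve_speed {..<m i} (factor_metric i) (\<lambda>t. block m (c t) i))
        \<in> path_lengths (block m \<theta>\<^sub>0 i) (block m \<theta>\<^sub>1 i)"
      unfolding path_lengths_def using factor_curve(1,2)[OF c(1,2) i] c(3,4) by blast
    from Inf_path_lengths_le[OF this] show ?thesis
      by (simp add: fisher_rao_dist_eq path_lengths_def)
  qed
  then have "L2_set (\<lambda>i. factor_dist i (block m \<theta>\<^sub>0 i) (block m \<theta>\<^sub>1 i)) {..<k} \<le>
      L2_set (\<lambda>i. integral {0..1} (curve_speed {..<m i} (factor_metric i) (\<lambda>t. block m (c t) i))) {..<k}"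
    using factor_dist_nonneg block_in_params \<theta> by (intro L2_set_mono) auto
  also have "\<dots> \<le> integral {0..1} (product_speed c)" by (rule product_length(2)[OF c(1,2)])
  finally show ?thesis .
qed

text \<open>The factor curves run over the same unit interval with speeds bounded by constants, so
  the product speed is bounded by the norm of these constants, and so is the length, the interval
  having length 1.\<close>

lemma product_curve_of_length_le:
  assumes \<theta>: "\<theta>\<^sub>0 \<in> product_params k m \<Theta>" "\<theta>\<^sub>1 \<in> product_params k m \<Theta>" and \<delta>: "0 < \<delta>"
  obtains c where "piecewise_smooth_curve (product_index k m) c" "c ` {0..1} \<subseteq> product_params k m \<Theta>"
    "c 0 = \<theta>\<^sub>0" "c 1 = \<theta>\<^sub>1"
    "integral {0..1} (product_speed c) \<le>
      L2_set (\<lambda>i. factor_dist i (block m \<theta>\<^sub>0 i) (block m \<theta>\<^sub>1 i) + \<delta>) {..<k}"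
proof -
  let ?\<rho> = "\<lambda>i. factor_dist i (block m \<theta>\<^sub>0 i) (block m \<theta>\<^sub>1 i)"
  define P where "P i c S \<longleftrightarrow> piecewise_smooth_curve {..<m i} c \<and> c ` {0..1} \<subseteq> \<Theta> i \<and> c 0 = block m \<theta>\<^sub>0 i \<and>
      c 1 = block m \<theta>\<^sub>1 i \<and> finite S \<and>
      (\<forall>t\<in>{0<..<1} - S. curve_speed {..<m i} (factor_metric i) c t \<le> ?\<rho> i + \<delta>)" for i c S
  have "\<exists>c S. P i c S" if i: "i < k" for i
  proof -
    interpret param_metric "{..<m i}" "\<Theta> i" "factor_metric i" by (rule factor_param_metric[OF i])
    have "reaches (block m \<theta>\<^sub>0 i) (block m \<theta>\<^sub>1 i) (?\<rho> i + \<delta>)"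
      using reaches_Inf_path_lengths[OF block_in_params[OF \<theta>(1) i] block_in_params[OF \<theta>(2) i] \<delta>]
      by (simp add: fisher_rao_dist_eq path_lengths_def)
    then obtain c S where "piecewise_smooth_curve {..<m i} c" "c ` {0..1} \<subseteq> \<Theta> i"
      "c 0 = block m \<theta>\<^sub>0 i" "c 1 = block m \<theta>\<^sub>1 i" "finite S"
      "\<And>t. t \<in> {0<..<1} - S \<Longrightarrow> curve_speed {..<m i} (factor_metric i) c t \<le> ?\<rho> i + \<delta>"
      by (rule reaches_imp_curve) blast
    then show ?thesis unfolding P_def by blast
  qed
  then obtain C S where "\<And>i. i < k \<Longrightarrow> P i (C i) (S i)" by metis
  then have C: "\<And>i. i < k \<Longrightarrow> piecewise_smooth_curve {..<m i} (C i)"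
      "\<And>i. i < k \<Longrightarrow> C i ` {0..1} \<subseteq> \<Theta> i"
      "\<And>i. i < k \<Longrightarrow> C i 0 = block m \<theta>\<^sub>0 i" "\<And>i. i < k \<Longrightarrow> C i 1 = block m \<theta>\<^sub>1 i"
    and S: "\<And>i. i < k \<Longrightarrow> finite (S i)"
      "\<And>i t. i < k \<Longrightarrow> t \<in> {0<..<1} - S i \<Longrightarrow> curve_speed {..<m i} (factor_metric i) (C i) t \<le> ?\<rho> i + \<delta>"
    unfolding P_def by auto
  define c where "c = (\<lambda>t. \<lambda>(i, j)\<in>product_index k m. C i t j)"
  have c_apply: "c t (i, j) = C i t j" if "i < k" "j < m i" for t i j
    using that by (simp add: c_def product_index_def)
  have block_c: "block m (c t) i = C i t" if "i < k" "t \<in> {0..1}" for t i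
  proof -
    interpret param_metric "{..<m i}" "\<Theta> i" "factor_metric i" by (rule factor_param_metric[OF that(1)])
    have "C i t \<in> extensional {..<m i}" using C(2) that by (intro params_extensional) blast
    then show ?thesis using that(1) by (intro block_product) (auto simp: c_apply)
  qed
  have c_smooth: "piecewise_smooth_curve (product_index k m) c"
    unfolding c_def using C(1) by (rule piecewise_smooth_curve_product)
  have "c t \<in> product_params k m \<Theta>" if t: "t \<in> {0..1}" for t
    unfolding product_params_def
  proof (intro CollectI conjI allI impI)
    show "c t \<in> product_index k m \<rightarrow>\<^sub>E UNIV" by (simp add: c_def)
    show "block m (c t) i \<in> \<Theta> i" if "i < k" for i
      using C(2) that t by (simp add: block_c image_subset_iff)
  qed
  then have c_params: "c ` {0..1} \<subseteq> product_params k m \<Theta>" by blast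
  \<comment> \<open>Equality of functions on all pairs: outside the index set both sides are
    \<open>undefined\<close>.\<close>
  have c_eq: "c t = \<theta>" if "\<theta> \<in> product_params k m \<Theta>" "\<And>i. i < k \<Longrightarrow> C i t = block m \<theta> i" for t \<theta>
  proof
    fix a
    show "c t a = \<theta> a"
    proof (cases "a \<in> product_index k m")
      case True
      then obtain i j where ij: "a = (i, j)" "i < k" "j < m i"
        by (auto simp: product_index_def)
      then show ?thesis
        using that(2)[OF ij(2)] by (simp add: c_apply block_apply)
    next
      case False
      then show ?thesis
        using that(1) PiE_arb[of \<theta> "product_index k m" "\<lambda>_. UNIV" a]
        by (simp add: c_def product_params_def)
    qed
  qed
  let ?B = "L2_set (\<lambda>i. ?\<rho> i + \<delta>) {..<k}"
  \<comment> \<open>The end points are excluded because the blocks of \<open>c\<close> are known to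
    agree with \<open>C i\<close> only on \<open>[0, 1]\<close>, and comparing derivatives takes a
    two-sided neighbourhood.\<close>
  define Q where "Q = {0, 1} \<union> (\<Union>i<k. S i)"
  have Q: "finite Q" unfolding Q_def using S(1) by simp
  have speed: "product_speed c t \<le> ?B" if t: "t \<in> {0..1} - Q" for t
  proof -
    have t': "t \<in> {0<..<1}" "\<And>i. i < k \<Longrightarrow> t \<notin> S i" using t unfolding Q_def by auto
    have f: "curve_speed {..<m i} (factor_metric i) (\<lambda>s. block m (c s) i) t
        = curve_speed {..<m i} (factor_metric i) (C i) t" if "i < k" for i
      by (rule curve_speed_cong[of "{0<..<1}"]) (use t'(1) block_c[OF that] in auto)
    have "product_speed c t = L2_set (\<lambda>i. curve_speed {..<m i} (factor_metric i) (\<lambda>s. block m (c s) i) t) {..<k}"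
      by (rule curve_speed_product) (use c_params t in blast)
    also have "\<dots> \<le> ?B"
    proof (rule L2_set_mono)
      fix i assume i: "i \<in> {..<k}"
      show "curve_speed {..<m i} (factor_metric i) (\<lambda>s. block m (c s) i) t \<le> ?\<rho> i + \<delta>"
        using S(2)[of i t] t' i by (simp add: f)
      show "0 \<le> curve_speed {..<m i} (factor_metric i) (\<lambda>s. block m (c s) i) t"
        using factor_curve(4)[OF c_smooth c_params] i t by simp
    qed
    finally show ?thesis .
  qed
  \<comment> \<open>No bound on the speed is available on the finite set \<open>Q\<close>, so its
    values there are replaced by the bound itself, which leaves the integral unchanged.\<close>
  have "integral {0..1} (product_speed c) = integral {0..1} (\<lambda>t. if t \<in> Q then ?B else product_speed c t)"
    by (rule integral_spike[OF negligible_finite[OF Q]]) simp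
  also have "\<dots> \<le> integral {0..1::real} (\<lambda>_. ?B)"
  proof (rule integral_le)
    show "(\<lambda>t. if t \<in> Q then ?B else product_speed c t) integrable_on {0..1}"
      by (rule integrable_spike_finite[OF Q _ product_length(1)[OF c_smooth c_params]]) simp
  qed (use speed in auto)
  also have "\<dots> = ?B" by simp
  finally show ?thesis
    using that[OF c_smooth c_params c_eq[OF \<theta>(1) C(3)] c_eq[OF \<theta>(2) C(4)]] by simp
qed

text \<open>The lower bound holds for every curve. The upper bound carries a slack
  \<open>\<delta>\<close> in each of the finitely many entries, which disappears as
  \<open>\<delta>\<close> tends to 0 from the right, by continuity of the norm.\<close>

lemma fisher_rao_dist_product:
  assumes \<theta>: "\<theta>\<^sub>0 \<in> product_params k m \<Theta>" "\<theta>\<^sub>1 \<in> product_params k m \<Theta>"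
  shows "fisher_rao_dist (product_index k m) (product_params k m \<Theta>)
      (\<Pi>\<^sub>M i\<in>{..<k}. \<mu> i) (product_density k m p) \<theta>\<^sub>0 \<theta>\<^sub>1 =
    L2_set (\<lambda>i. factor_dist i (block m \<theta>\<^sub>0 i) (block m \<theta>\<^sub>1 i)) {..<k}"
proof -
  let ?\<rho> = "\<lambda>i. factor_dist i (block m \<theta>\<^sub>0 i) (block m \<theta>\<^sub>1 i)"
  let ?A = "{integral {0..1} (product_speed c) | c. piecewise_smooth_curve (product_index k m) c \<and>
     c ` {0..1} \<subseteq> product_params k m \<Theta> \<and> c 0 = \<theta>\<^sub>0 \<and> c 1 = \<theta>\<^sub>1}"
  have lower: "L2_set ?\<rho> {..<k} \<le> r" if "r \<in> ?A" for r
    using that product_length_ge[OF \<theta>] by blast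
  have ex: "\<exists>r\<in>?A. r \<le> L2_set (\<lambda>i. ?\<rho> i + \<delta>) {..<k}" if "0 < \<delta>" for \<delta>
    by (rule product_curve_of_length_le[OF \<theta> that]) blast
  have "Inf ?A \<le> L2_set (\<lambda>i. ?\<rho> i + \<delta>) {..<k}" if \<delta>: "0 < \<delta>" for \<delta>
  proof -
    obtain r where r: "r \<in> ?A" "r \<le> L2_set (\<lambda>i. ?\<rho> i + \<delta>) {..<k}" using ex[OF \<delta>] ..
    have "bdd_below ?A" using lower by (rule bdd_belowI)
    with r(1) have "Inf ?A \<le> r" by (rule cInf_lower)
    then show ?thesis using r(2) by (rule order_trans)
  qed
  then have "\<forall>\<^sub>F \<delta> in at_right 0. Inf ?A \<le> L2_set (\<lambda>i. ?\<rho> i + \<delta>) {..<k}"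
    by (simp add: eventually_at_right_less eventually_at_filter)
  moreover have "((\<lambda>\<delta>. L2_set (\<lambda>i. ?\<rho> i + \<delta>) {..<k}) \<longlongrightarrow> L2_set (\<lambda>i. ?\<rho> i + 0) {..<k}) (at_right 0)"
    unfolding L2_set_def by (intro tendsto_intros)
  ultimately have "Inf ?A \<le> L2_set (\<lambda>i. ?\<rho> i + 0) {..<k}"
    by (intro tendsto_lowerbound) auto
  moreover have "?A \<noteq> {}" using ex[of 1] by auto
  then have "L2_set ?\<rho> {..<k} \<le> Inf ?A" using lower by (rule cInf_greatest)
  ultimately show ?thesis by (simp add: fisher_rao_dist_eq)
qed

end

theorem proposition3:
  fixes k :: nat and d m :: "nat \<Rightarrow> nat"
    and \<Theta> :: "nat \<Rightarrow> (nat \<Rightarrow> real) set"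
    and \<mu> :: "nat \<Rightarrow> (nat \<Rightarrow> real) measure"
    and p :: "nat \<Rightarrow> (nat \<Rightarrow> real) \<Rightarrow> (nat \<Rightarrow> real) \<Rightarrow> real"
    and \<theta>\<^sub>0 \<theta>\<^sub>1 :: "nat \<times> nat \<Rightarrow> real"
  assumes "\<And>i. i < k \<Longrightarrow> sets (\<mu> i) = sets (\<Pi>\<^sub>M j\<in>{..<d i}. borel)"
    and "\<And>i. i < k \<Longrightarrow> regular_statistical_model {..<m i} (\<Theta> i) (\<mu> i) (p i)"
    and "\<theta>\<^sub>0 \<in> product_params k m \<Theta>"
    and "\<theta>\<^sub>1 \<in> product_params k m \<Theta>"
  shows "fisher_rao_dist (product_index k m) (product_params k m \<Theta>)
           (\<Pi>\<^sub>M i\<in>{..<k}. \<mu> i) (product_density k m p) \<theta>\<^sub>0 \<theta>\<^sub>1 =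
         sqrt (\<Sum>i<k. (fisher_rao_dist {..<m i} (\<Theta> i) (\<mu> i) (p i)
                         (block m \<theta>\<^sub>0 i) (block m \<theta>\<^sub>1 i))\<^sup>2)"
proof -
  interpret product_model k m \<Theta> \<mu> p
    using assms(2) by (rule product_model.intro)
  show ?thesis
    using fisher_rao_dist_product[OF assms(3,4)] by (simp add: L2_set_def)
qed

end
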